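(* Let $(R,\mathfrak m)$ be an OK domain of dimension $d\ge1$. (a) Let $I_\bullet=\{I_n\}_{n\in\mathbb N}$ be a BBL weakly graded family of ideals of $R$. Then $I_\bullet$ is BAL if and only if $$\lim_{n\to\infty}\frac{\ell(R/I_n)}{n^d}>0.$$ (b) Assume $R$ has prime characteristic $p>0$. Let $I_\bullet=\{I_q\}_{q=p^e,\,e\in\mathbb N}$ be either a BBL weakly $p$-family of ideals, or, when $R$ is $F$-finite with perfect residue field, a BBL weakly inverse $p$-family of ideals. Then $I_\bullet$ is BAL if and only if $$\lim_{q\to\infty}\frac{\ell(R/I_q)}{q^d}>0.$$
   Context: OK domain. Let $(R,\mathfrak m,\Bbbk)$ be a Noetherian local domain of dimension $d\ge1$ with fraction field $\mathbb F$. Fix $\mathbf a\in\mathbb R^d$ with $\mathbb Q$-linearly independent components; order $\mathbb Z^d$ by $\mathbf u\le\mathbf v$ iff $\langle\mathbf u,\mathbf a\rangle\le\langle\mathbf v,\mathbf a\rangle$. For a valuation $\nu:\mathbb F^\times\to\mathbb Z^d$ put $\mathbb F_{\ge\mathbf u}=\{x\in\mathbb F^\times:\nu(x)\ge\mathbf u\}\cup\{0\}$, let $(V_\nu,\mathfrak m_\nu,\Bbbk_\nu)$ be its valuation ring, and for $N\subset\mathbb F$ put $\nu(N)=\nu(N\setminus\{0\})$. $\nu$ is OK relative to $R$ if: (1) $\nu(R)$ generates $\mathbb Z^d$ as a group; (2) $R\subset V_\nu$ and $\mathfrak m\subset\mathfrak m_\nu$; (3) the closed convex cone generated by $\nu(R)$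 is contained in $\{\mathbf x:\langle\mathbf x,\mathbf a\rangle\ge c_1\|\mathbf x\|\}$ for some $0<c_1<\|\mathbf a\|$; (4) $[\Bbbk_\nu:\Bbbk]<\infty$; (5) there is $\mathbf v\in\mathbb Z^d$ with $R\cap\mathbb F_{\ge n\mathbf v}\subset\mathfrak m^n$ for all $n\in\mathbb N$. $R$ is an OK domain if such a $\nu$ exists (for some $\mathbf a$). Families. $\mathbb N$ contains $0$; $I^{[q]}=(a^q:a\in I)$ for $q=p^e$. $\{I_n\}_{n\in\mathbb N}$ is weakly graded if there is $0\ne c\in R$ with $cI_mI_n\subset I_{m+n}$ for all $m,n$. $\{I_q\}_{q=p^e,e\in\mathbb N}$ is a weakly $p$-family if there is $0\ne c\in R$ with $cI_q^{[p]}\subset I_{pq}$ for all $q$, and a weakly inverse $p$-family if there is $0\neq c\in R$ with $cI_{pq}\subset I_q^{[p]}$ for all $q$. BBL (bounded below linearly): there is $c\in\mathbb N$ with $\mathfrak m^{cn}\subset I_n$ for all $n$ (resp. $\mathfrak m^{cq}\subset I_q$ for all $q=p^e$). BAL (bounded above linearly): for families indexed by $\mathbb N$, there is a positive integer $c$ with $I_n\subset\mathfrak m^{\lfloor n/c\rfloor}$ for all $n$; for families indexed by powers of $p$, there is a power $q_0$ of $p$ with $I_{qq_0}\subset\mathfrak m^{[q]}$ for all $q=p^e$. $R$ is $F$-finite if it is a finite module over itself via Frobenius. In all cases considered the limits in the claim are known to exist. *)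

theory Defs
  imports
    "HOL-Analysis.Analysis"
    "HOL-Algebra.Algebraic_Closure_Type"
    "HOL-Algebra.Ideal_Product"
    "HOL-Computational_Algebra.Group_Closure"
begin

hide_const (open) Divisibility.prime

section \<open>Local domains inside their fraction field\<close>

text \<open>
  The fraction field is a type \<open>'k\<close> of class \<open>field\<close>, and the domain is a subset \<open>R\<close> of it whose
  quotients exhaust \<open>'k\<close>.  This loses no generality, and it allows intersections such as
  \<open>R \<inter> F\<^sub>\<ge>\<^sub>u\<close> to be written literally.
\<close>

definition ring_on :: "'k::field set \<Rightarrow> 'k ring" where
  "ring_on R = ring_of_type_algebra\<lparr>carrier := R\<rparr>"

locale noetherian_local_domain =
  fixes R :: "'k::field set" and \<mm> :: "'k set"
  assumes noetherian: "noetherian_domain (ring_on R)"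
    and maximal: "maximalideal \<mm> (ring_on R)"
    and unique_maximal: "maximalideal J (ring_on R) \<Longrightarrow> J = \<mm>"
    and fraction_field: "\<exists>a\<in>R. \<exists>b\<in>R. b \<noteq> 0 \<and> x = a / b"

definition krull_dim :: "('a, 'b) ring_scheme \<Rightarrow> enat" where
  "krull_dim R = Sup {enat n | n.
     \<exists>P. (\<forall>i\<le>n. primeideal (P i) R) \<and> (\<forall>i<n. P i \<subset> P (Suc i))}"

definition ideal_power :: "('a, 'b) ring_scheme \<Rightarrow> 'a set \<Rightarrow> nat \<Rightarrow> 'a set" where
  "ideal_power R I n = I [^]\<^bsub>ideals_set R\<^esub> n"

definition frobenius_power :: "('a, 'b) ring_scheme \<Rightarrow> 'a set \<Rightarrow> nat \<Rightarrow> 'a set" where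
  "frobenius_power R I q = genideal R ((\<lambda>a. a [^]\<^bsub>R\<^esub> q) ` I)"

definition module_length :: "('a, 'c) ring_scheme \<Rightarrow> ('a, 'b, 'd) module_scheme \<Rightarrow> enat" where
  "module_length R M = Sup {enat n | n.
     \<exists>N. (\<forall>i\<le>n. submodule (N i) R M) \<and> (\<forall>i<n. N i \<subset> N (Suc i))}"

definition quot_module :: "('a, 'b) ring_scheme \<Rightarrow> 'a set \<Rightarrow> ('a, 'a set) module" where
  "quot_module R I =
     ring.extend (R Quot I) (module.fields (\<lambda>r Y. (I +>\<^bsub>R\<^esub> r) \<otimes>\<^bsub>R Quot I\<^esub> Y))"

lemma quot_module_simps [simp]:
  "carrier (quot_module R I) = carrier (R Quot I)"
  "add (quot_module R I) = add (R Quot I)"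
  "zero (quot_module R I) = zero (R Quot I)"
  "smult (quot_module R I) r Y = (I +>\<^bsub>R\<^esub> r) \<otimes>\<^bsub>R Quot I\<^esub> Y"
  by (auto simp: quot_module_def ring.defs module.defs)

lemma module_quot_module:
  assumes "cring R" "ideal I R"
  shows "module R (quot_module R I)"
proof -
  interpret I: ideal I R by fact
  interpret Q: cring "R Quot I" using I.quotient_is_cring[OF assms(1)] .
  have h: "(+>\<^bsub>R\<^esub>) I \<in> ring_hom R (R Quot I)" using I.rcos_ring_hom .
  have ag: "abelian_group (quot_module R I)"
    by (rule abelian_groupI) (simp_all add: Q.a_ac Q.add.l_inv_ex)
  have c: "I +>\<^bsub>R\<^esub> r \<in> carrier (R Quot I)" if "r \<in> carrier R" for r
    using ring_hom_closed[OF h that] .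
  show ?thesis
    by (rule moduleI[OF assms(1) ag])
      (simp_all add: c Q.l_distr Q.r_distr Q.m_assoc
        ring_hom_add[OF h] ring_hom_mult[OF h] ring_hom_one[OF h])
qed

definition colength :: "('a, 'b) ring_scheme \<Rightarrow> 'a set \<Rightarrow> enat" where
  "colength R I = module_length R (quot_module R I)"


section \<open>OK valuations\<close>

definition real_vec :: "int ^ 'n \<Rightarrow> real ^ 'n" where
  "real_vec u = (\<chi> i. of_int (u $ i))"

text \<open>\<open>vle a\<close> and \<open>vless a\<close> order the lattice \<open>int ^ 'n\<close> by the inner product with \<open>a\<close>.\<close>

definition vle :: "real ^ 'n \<Rightarrow> int ^ 'n \<Rightarrow> int ^ 'n \<Rightarrow> bool" where
  "vle a u v \<longleftrightarrow> real_vec u \<bullet> a \<le> real_vec v \<bullet> a"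

definition vless :: "real ^ 'n \<Rightarrow> int ^ 'n \<Rightarrow> int ^ 'n \<Rightarrow> bool" where
  "vless a u v \<longleftrightarrow> real_vec u \<bullet> a < real_vec v \<bullet> a"

definition rationally_independent :: "real ^ 'n \<Rightarrow> bool" where
  "rationally_independent a \<longleftrightarrow>
     (\<forall>r :: 'n \<Rightarrow> rat. (\<Sum>i\<in>UNIV. of_rat (r i) * a $ i) = 0 \<longrightarrow> (\<forall>i. r i = 0))"

text \<open>A valuation is only meaningful on nonzero elements; its value at \<open>0\<close> is never used.\<close>

definition is_valuation :: "real ^ 'n \<Rightarrow> ('k::field \<Rightarrow> int ^ 'n) \<Rightarrow> bool" where
  "is_valuation a \<nu> \<longleftrightarrow>
     (\<forall>x y. x \<noteq> 0 \<longrightarrow> y \<noteq> 0 \<longrightarrow> \<nu> (x * y) = \<nu> x + \<nu> y) \<and>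
     (\<forall>x y. x \<noteq> 0 \<longrightarrow> y \<noteq> 0 \<longrightarrow> x + y \<noteq> 0 \<longrightarrow>
        vle a (\<nu> x) (\<nu> (x + y)) \<or> vle a (\<nu> y) (\<nu> (x + y)))"

definition val_ge :: "real ^ 'n \<Rightarrow> ('k::field \<Rightarrow> int ^ 'n) \<Rightarrow> int ^ 'n \<Rightarrow> 'k set" where
  "val_ge a \<nu> u = {x. x \<noteq> 0 \<and> vle a u (\<nu> x)} \<union> {0}"

definition val_ring :: "real ^ 'n \<Rightarrow> ('k::field \<Rightarrow> int ^ 'n) \<Rightarrow> 'k set" where
  "val_ring a \<nu> = {x. x \<noteq> 0 \<and> vle a 0 (\<nu> x)} \<union> {0}"

definition val_maximal :: "real ^ 'n \<Rightarrow> ('k::field \<Rightarrow> int ^ 'n) \<Rightarrow> 'k set" where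
  "val_maximal a \<nu> = {x. x \<noteq> 0 \<and> vless a 0 (\<nu> x)} \<union> {0}"

definition val_residue_field :: "real ^ 'n \<Rightarrow> ('k::field \<Rightarrow> int ^ 'n) \<Rightarrow> 'k set ring" where
  "val_residue_field a \<nu> = ring_on (val_ring a \<nu>) Quot val_maximal a \<nu>"

text \<open>
  For \<open>R \<subseteq> val_ring a \<nu>\<close> and \<open>\<mm> \<subseteq> val_maximal a \<nu>\<close> with \<open>\<mm>\<close> maximal, this is an isomorphic copy of
  \<open>R/\<mm>\<close> inside the residue field of the valuation.
\<close>

definition residue_image :: "real ^ 'n \<Rightarrow> ('k::field \<Rightarrow> int ^ 'n) \<Rightarrow> 'k set \<Rightarrow> 'k set set" where
  "residue_image a \<nu> R =
     (\<lambda>r. val_maximal a \<nu> +>\<^bsub>ring_on (val_ring a \<nu>)\<^esub> r) ` R"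

definition OK_valuation ::
    "real ^ 'n \<Rightarrow> ('k::field \<Rightarrow> int ^ 'n) \<Rightarrow> 'k set \<Rightarrow> 'k set \<Rightarrow> bool" where
  "OK_valuation a \<nu> R \<mm> \<longleftrightarrow>
     is_valuation a \<nu> \<and>
     group_closure (\<nu> ` (R - {0})) = UNIV \<and>
     R \<subseteq> val_ring a \<nu> \<and> \<mm> \<subseteq> val_maximal a \<nu> \<and>
     (\<exists>c\<^sub>1. 0 < c\<^sub>1 \<and> c\<^sub>1 < norm a \<and>
        closure (convex_cone hull (real_vec ` \<nu> ` (R - {0}))) \<subseteq> {x. x \<bullet> a \<ge> c\<^sub>1 * norm x}) \<and>
     ring.finite_dimension (val_residue_field a \<nu>)
       (residue_image a \<nu> R) (carrier (val_residue_field a \<nu>)) \<and>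
     (\<exists>v. \<forall>n::nat. R \<inter> val_ge a \<nu> (int n *s v) \<subseteq> ideal_power (ring_on R) \<mm> n)"

text \<open>The rank of the value group is \<open>d = CARD('n)\<close>, and it has to be the dimension of \<open>R\<close>.\<close>

definition OK_domain :: "'n::finite itself \<Rightarrow> 'k::field set \<Rightarrow> 'k set \<Rightarrow> bool" where
  "OK_domain _ R \<mm> \<longleftrightarrow>
     noetherian_local_domain R \<mm> \<and>
     krull_dim (ring_on R) = enat CARD('n) \<and>
     (\<exists>(a :: real ^ 'n) \<nu>. rationally_independent a \<and> OK_valuation a \<nu> R \<mm>)"


section \<open>Families of ideals\<close>

text \<open>
  A family indexed by the powers of \<open>p\<close> is a function on \<open>nat\<close> of which only the values at
  powers of \<open>p\<close> are used.
\<close>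

definition weakly_graded :: "'k::field set \<Rightarrow> (nat \<Rightarrow> 'k set) \<Rightarrow> bool" where
  "weakly_graded R I \<longleftrightarrow> (\<forall>n. ideal (I n) (ring_on R)) \<and>
     (\<exists>c\<in>R. c \<noteq> 0 \<and> (\<forall>m n. (*) c ` ideal_prod (ring_on R) (I m) (I n) \<subseteq> I (m + n)))"

definition weakly_p_family :: "nat \<Rightarrow> 'k::field set \<Rightarrow> (nat \<Rightarrow> 'k set) \<Rightarrow> bool" where
  "weakly_p_family p R I \<longleftrightarrow> (\<forall>e. ideal (I (p ^ e)) (ring_on R)) \<and>
     (\<exists>c\<in>R. c \<noteq> 0 \<and>
        (\<forall>e. (*) c ` frobenius_power (ring_on R) (I (p ^ e)) p \<subseteq> I (p * p ^ e)))"

definition weakly_inverse_p_family :: "nat \<Rightarrow> 'k::field set \<Rightarrow> (nat \<Rightarrow> 'k set) \<Rightarrow> bool" where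
  "weakly_inverse_p_family p R I \<longleftrightarrow> (\<forall>e. ideal (I (p ^ e)) (ring_on R)) \<and>
     (\<exists>c\<in>R. c \<noteq> 0 \<and>
        (\<forall>e. (*) c ` I (p * p ^ e) \<subseteq> frobenius_power (ring_on R) (I (p ^ e)) p))"

definition BBL :: "'k::field set \<Rightarrow> 'k set \<Rightarrow> (nat \<Rightarrow> 'k set) \<Rightarrow> bool" where
  "BBL R \<mm> I \<longleftrightarrow> (\<exists>c::nat. \<forall>n. ideal_power (ring_on R) \<mm> (c * n) \<subseteq> I n)"

definition BBL_p :: "nat \<Rightarrow> 'k::field set \<Rightarrow> 'k set \<Rightarrow> (nat \<Rightarrow> 'k set) \<Rightarrow> bool" where
  "BBL_p p R \<mm> I \<longleftrightarrow> (\<exists>c::nat. \<forall>e. ideal_power (ring_on R) \<mm> (c * p ^ e) \<subseteq> I (p ^ e))"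

definition BAL :: "'k::field set \<Rightarrow> 'k set \<Rightarrow> (nat \<Rightarrow> 'k set) \<Rightarrow> bool" where
  "BAL R \<mm> I \<longleftrightarrow> (\<exists>c::nat. c > 0 \<and> (\<forall>n. I n \<subseteq> ideal_power (ring_on R) \<mm> (n div c)))"

definition BAL_p :: "nat \<Rightarrow> 'k::field set \<Rightarrow> 'k set \<Rightarrow> (nat \<Rightarrow> 'k set) \<Rightarrow> bool" where
  "BAL_p p R \<mm> I \<longleftrightarrow>
     (\<exists>e\<^sub>0. \<forall>e. I (p ^ e * p ^ e\<^sub>0) \<subseteq> frobenius_power (ring_on R) \<mm> (p ^ e))"


section \<open>Conditions in characteristic \<open>p\<close>\<close>

text \<open>\<open>R\<close> is a finite module over itself via \<open>x \<mapsto> x ^ p\<close>.\<close>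

definition F_finite :: "nat \<Rightarrow> 'k::field set \<Rightarrow> bool" where
  "F_finite p R \<longleftrightarrow>
     (\<exists>B. finite B \<and> B \<subseteq> R \<and> (\<forall>x\<in>R. \<exists>r. (\<forall>b\<in>B. r b \<in> R) \<and> x = (\<Sum>b\<in>B. r b ^ p * b)))"

text \<open>A field of characteristic \<open>p > 0\<close> is perfect iff its Frobenius map is onto.\<close>

definition perfect_residue_field :: "nat \<Rightarrow> 'k::field set \<Rightarrow> 'k set \<Rightarrow> bool" where
  "perfect_residue_field p R \<mm> \<longleftrightarrow>
     (\<forall>x\<in>carrier (ring_on R Quot \<mm>). \<exists>y\<in>carrier (ring_on R Quot \<mm>).
        y [^]\<^bsub>ring_on R Quot \<mm>\<^esub> p = x)"


section \<open>Normalised colengths\<close>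

definition normalized_colength ::
    "'k::field set \<Rightarrow> nat \<Rightarrow> (nat \<Rightarrow> 'k set) \<Rightarrow> nat \<Rightarrow> ereal" where
  "normalized_colength R d I n =
     ereal_of_enat (colength (ring_on R) (I n)) / ereal (real n ^ d)"

end

theory Submission
  imports Defs
begin

text \<open>
  Let \<open>h x = \<langle>\<nu> x, a\<rangle>\<close> and let \<open>Rge t\<close> be the ideal of elements of \<open>R\<close> with \<open>h x \<ge> t\<close>.  Up to
  linear rescaling of the index, these ideals are cofinal with the powers of \<open>\<mm>\<close>.

  If the family is BAL, its members lie in ideals \<open>Rge t\<close> with \<open>t\<close> growing linearly, and
  \<open>\<ell>(R/Rge t)\<close> is at least the number of values below \<open>t\<close>.  As \<open>\<nu>(R)\<close> contains \<open>d\<close> linearly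
  independent vectors, this number grows like \<open>t\<^sup>d\<close>.

  If the family is not BAL, there are infinitely many \<open>n\<close> with elements \<open>x\<close> in \<open>I\<^sub>n\<close> for which
  \<open>h x / n\<close> is arbitrarily small.  By BBL the ideal \<open>I\<^sub>n\<close> contains \<open>xR + Rge t\<close> with \<open>t\<close> linear
  in \<open>n\<close>, and \<open>\<ell>(R/(xR + Rge t)) = \<ell>(Rge (t - h x)/Rge t)\<close>.  The latter is at most
  \<open>[k\<^sub>\<nu> : k]\<close> times the number of lattice points in a slab of width \<open>h x\<close> of a pointed cone,
  which is of order \<open>(h x + 1) n\<^sup>d\<^sup>-\<^sup>1\<close>.  Since the limit is assumed to exist, it must be \<open>0\<close>.
\<close>

section \<open>Lengths of quotients by ideals of a subring of a field\<close>

lemma ring_on_simps [simp]: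
  "carrier (ring_on R) = R" "monoid.mult (ring_on R) = (*)" "one (ring_on R) = 1"
  "ring.zero (ring_on R) = 0" "add (ring_on R) = (+)"
  by (auto simp: ring_on_def ring_of_type_algebra_def fun_eq_iff)

lemma a_coset_ring_on: "I +>\<^bsub>ring_on R\<^esub> r = (\<lambda>j. j + r) ` I"
  by (auto simp: a_r_coset_def r_coset_def)

text \<open>Serves both for the domain \<open>R\<close> and for the valuation ring, hence only
  closure properties inside the ambient field.\<close>

locale subring_on =
  fixes R :: "'k::field set"
  assumes one_mem: "1 \<in> R"
    and diff_mem: "x \<in> R \<Longrightarrow> y \<in> R \<Longrightarrow> x - y \<in> R"
    and mult_mem: "x \<in> R \<Longrightarrow> y \<in> R \<Longrightarrow> x * y \<in> R"
begin

lemma zero_mem: "0 \<in> R"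
  using diff_mem[OF one_mem one_mem] by simp

lemma uminus_mem: "x \<in> R \<Longrightarrow> - x \<in> R"
  using diff_mem[OF zero_mem] by simp

lemma add_mem: "x \<in> R \<Longrightarrow> y \<in> R \<Longrightarrow> x + y \<in> R"
  using diff_mem[of x "- y"] uminus_mem by simp

lemma power_mem: "x \<in> R \<Longrightarrow> x ^ n \<in> R"
  by (induction n) (auto simp: one_mem mult_mem)

lemma cring_ring_on: "cring (ring_on R)"
proof (intro cringI abelian_groupI comm_monoidI)
  fix x assume "x \<in> carrier (ring_on R)"
  then show "\<exists>y\<in>carrier (ring_on R). y \<oplus>\<^bsub>ring_on R\<^esub> x = \<zero>\<^bsub>ring_on R\<^esub>"
    using uminus_mem by (intro bexI[of _ "- x"]) auto
qed (auto simp: zero_mem one_mem add_mem mult_mem algebra_simps)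

sublocale cr: cring "ring_on R"
  by (rule cring_ring_on)

lemma nat_pow_ring_on: "x [^]\<^bsub>ring_on R\<^esub> (n::nat) = x ^ n"
  by (induction n) auto

section \<open>Submodules of the ambient field\<close>

definition submodule_on :: "'k set \<Rightarrow> bool" where
  "submodule_on A \<longleftrightarrow> 0 \<in> A \<and> (\<forall>x\<in>A. \<forall>y\<in>A. x + y \<in> A) \<and> (\<forall>r\<in>R. \<forall>x\<in>A. r * x \<in> A)"

lemma submodule_onI:
  assumes "0 \<in> A" "\<And>x y. x \<in> A \<Longrightarrow> y \<in> A \<Longrightarrow> x + y \<in> A"
    "\<And>r x. r \<in> R \<Longrightarrow> x \<in> A \<Longrightarrow> r * x \<in> A"
  shows "submodule_on A"
  using assms by (auto simp: submodule_on_def)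

lemma submodule_onD:
  assumes "submodule_on A"
  shows "0 \<in> A" "x \<in> A \<Longrightarrow> y \<in> A \<Longrightarrow> x + y \<in> A" "r \<in> R \<Longrightarrow> x \<in> A \<Longrightarrow> r * x \<in> A"
    "x \<in> A \<Longrightarrow> - x \<in> A" "x \<in> A \<Longrightarrow> y \<in> A \<Longrightarrow> x - y \<in> A"
proof -
  show *: "0 \<in> A" "x \<in> A \<Longrightarrow> y \<in> A \<Longrightarrow> x + y \<in> A" "r \<in> R \<Longrightarrow> x \<in> A \<Longrightarrow> r * x \<in> A" for x y r
    using assms by (auto simp: submodule_on_def)
  show **: "x \<in> A \<Longrightarrow> - x \<in> A" for x
    using *(3)[of "- 1" x] uminus_mem[OF one_mem] by simp
  show "x \<in> A \<Longrightarrow> y \<in> A \<Longrightarrow> x - y \<in> A"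
    using *(2)[of x "- y"] **[of y] by simp
qed

lemma ideal_iff: "ideal J (ring_on R) \<longleftrightarrow> submodule_on J \<and> J \<subseteq> R"
proof
  assume "ideal J (ring_on R)"
  then interpret J: ideal J "ring_on R" .
  have "J \<subseteq> R"
    using J.a_subset by simp
  then show "submodule_on J \<and> J \<subseteq> R"
    using J.zero_closed J.a_closed J.I_l_closed by (auto intro!: submodule_onI)
next
  assume J: "submodule_on J \<and> J \<subseteq> R"
  then show "ideal J (ring_on R)"
  proof (intro idealI[OF cr.ring_axioms] cr.add.subgroupI)
    fix a x assume "a \<in> J" "x \<in> carrier (ring_on R)"
    then show "a \<otimes>\<^bsub>ring_on R\<^esub> x \<in> J"
      using J by (auto simp: submodule_on_def mult.commute[of a])
  next
    fix x assume "x \<in> J"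
    then have "\<ominus>\<^bsub>ring_on R\<^esub> x = - x"
      using J uminus_mem by (intro cr.minus_equality) auto
    then show "\<ominus>\<^bsub>ring_on R\<^esub> x \<in> J"
      using J \<open>x \<in> J\<close> submodule_onD(4) by simp
  qed (use J in \<open>auto simp: submodule_on_def\<close>)
qed

lemma submodule_on_self: "submodule_on R"
  by (rule submodule_onI) (auto simp: zero_mem add_mem mult_mem)

lemma submodule_on_Int: "submodule_on A \<Longrightarrow> submodule_on B \<Longrightarrow> submodule_on (A \<inter> B)"
  by (auto simp: submodule_on_def)

definition msum :: "'k set \<Rightarrow> 'k set \<Rightarrow> 'k set" where
  "msum A B = {a + b | a b. a \<in> A \<and> b \<in> B}"

lemma submodule_on_msum:
  assumes "submodule_on A" "submodule_on B"
  shows "submodule_on (msum A B)"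
proof (rule submodule_onI)
  show "0 \<in> msum A B"
    using assms submodule_onD(1) unfolding msum_def by (metis (mono_tags, lifting) add_0 mem_Collect_eq)
next
  fix x y assume "x \<in> msum A B" "y \<in> msum A B"
  then obtain a b a' b' where "x = a + b" "y = a' + b'" "a \<in> A" "a' \<in> A" "b \<in> B" "b' \<in> B"
    by (auto simp: msum_def)
  then show "x + y \<in> msum A B"
    unfolding msum_def using assms submodule_onD(2)
    by (intro CollectI exI[of _ "a + a'"] exI[of _ "b + b'"]) (auto simp: algebra_simps)
next
  fix r x assume "r \<in> R" "x \<in> msum A B"
  then show "r * x \<in> msum A B"
    unfolding msum_def using submodule_onD(3)[OF assms(1)] submodule_onD(3)[OF assms(2)]
    by (fastforce simp: distrib_left)
qed

lemma msum_upper1: "submodule_on B \<Longrightarrow> A \<subseteq> msum A B"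
  unfolding msum_def using submodule_onD(1) by force

lemma msum_upper2: "submodule_on A \<Longrightarrow> B \<subseteq> msum A B"
  unfolding msum_def using submodule_onD(1) by force

lemma submodule_on_scale:
  assumes "submodule_on A"
  shows "submodule_on ((*) x ` A)"
proof (rule submodule_onI)
  fix u v assume "u \<in> (*) x ` A" "v \<in> (*) x ` A"
  then obtain a b where "u = x * a" "v = x * b" "a \<in> A" "b \<in> A" by auto
  then show "u + v \<in> (*) x ` A"
    using submodule_onD(2)[OF assms, of a b] by (auto simp: distrib_left[symmetric])
next
  fix r u assume "r \<in> R" "u \<in> (*) x ` A"
  then show "r * u \<in> (*) x ` A"
    using submodule_onD(3)[OF assms] by (auto simp: mult.left_commute)
qed (use submodule_onD(1)[OF assms] in auto)

section \<open>Chains of submodules between two bounds\<close>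

text \<open>A chain of length \<open>n\<close> in \<open>B / A\<close>, written without quotients
  through the correspondence of submodules. The bounds need not occur in the chain, which makes the
  notion monotone in both.\<close>

definition chain_between :: "'k set \<Rightarrow> 'k set \<Rightarrow> nat \<Rightarrow> bool" where
  "chain_between A B n \<longleftrightarrow>
     (\<exists>N. (\<forall>i\<le>n. submodule_on (N i) \<and> A \<subseteq> N i \<and> N i \<subseteq> B) \<and> (\<forall>i<n. N i \<subset> N (Suc i)))"

lemma chain_between_mono:
  assumes "chain_between A B n" "A' \<subseteq> A" "B \<subseteq> B'" "m \<le> n"
  shows "chain_between A' B' m"
proof -
  obtain N where "\<And>i. i \<le> n \<Longrightarrow> submodule_on (N i) \<and> A \<subseteq> N i \<and> N i \<subseteq> B"
    "\<And>i. i < n \<Longrightarrow> N i \<subset> N (Suc i)"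
    using assms(1) unfolding chain_between_def by auto
  then have "\<And>i. i \<le> m \<Longrightarrow> submodule_on (N i) \<and> A' \<subseteq> N i \<and> N i \<subseteq> B'"
    "\<And>i. i < m \<Longrightarrow> N i \<subset> N (Suc i)"
    using assms(2-4) by (meson order.trans order_less_le_trans)+
  then show ?thesis
    unfolding chain_between_def by blast
qed

lemma chain_between_0: "submodule_on A \<Longrightarrow> A \<subseteq> B \<Longrightarrow> chain_between A B 0"
  unfolding chain_between_def by (rule exI[of _ "\<lambda>_. A"]) auto

lemma chain_between_append:
  assumes "chain_between A B m" "chain_between B C n"
  shows "chain_between A C (m + n)"
proof -
  obtain M where M: "\<And>i. i \<le> m \<Longrightarrow> submodule_on (M i) \<and> A \<subseteq> M i \<and> M i \<subseteq> B"
    "\<And>i. i < m \<Longrightarrow> M i \<subset> M (Suc i)"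
    using assms(1) unfolding chain_between_def by auto
  obtain N where N: "\<And>i. i \<le> n \<Longrightarrow> submodule_on (N i) \<and> B \<subseteq> N i \<and> N i \<subseteq> C"
    "\<And>i. i < n \<Longrightarrow> N i \<subset> N (Suc i)"
    using assms(2) unfolding chain_between_def by auto
  have AB: "A \<subseteq> B" "B \<subseteq> C"
    using M(1)[of 0] N(1)[of 0] by auto
  \<comment> \<open>At the seam the chain jumps from \<open>M m\<close> to \<open>N 1\<close>,
    skipping \<open>N 0\<close>; the jump is strict because
    \<open>M m \<subseteq> B \<subseteq> N 0 \<subset> N 1\<close>.\<close>
  define L where "L i = (if i \<le> m then M i else N (i - m))" for i
  have "L i \<subset> L (Suc i)" if i: "i < m + n" for i
  proof -
    consider "Suc i \<le> m" | "i = m" "0 < n" | "m < i" using i by linarith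
    then show ?thesis
    proof cases
      case 2
      then have "M m \<subseteq> N 0" "N 0 \<subset> N 1"
        using M(1)[of m] N(1)[of 0] N(2)[of 0] by auto
      with 2 show ?thesis by (auto simp: L_def)
    next
      case 3
      then show ?thesis using N(2)[of "i - m"] i by (auto simp: L_def Suc_diff_le)
    qed (auto simp: L_def M(2))
  qed
  moreover have "submodule_on (L i) \<and> A \<subseteq> L i \<and> L i \<subseteq> C" if "i \<le> m + n" for i
  proof (cases "i \<le> m")
    case True
    then show ?thesis using M(1)[of i] AB by (auto simp: L_def)
  next
    case False
    then have "submodule_on (N (i - m)) \<and> B \<subseteq> N (i - m) \<and> N (i - m) \<subseteq> C"
      using that by (intro N(1)) simp
    then show ?thesis using AB False by (auto simp: L_def)
  qed
  ultimately show ?thesis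
    unfolding chain_between_def by blast
qed

text \<open>Deleting repetitions from a weakly increasing chain leaves a strict one. This recovers
  chains after intersecting with, or adding, a fixed submodule.\<close>

lemma chain_between_strict_steps:
  assumes "\<And>i. i \<le> n \<Longrightarrow> submodule_on (N i)" "A \<subseteq> N 0" "\<And>i. i < n \<Longrightarrow> N i \<subseteq> N (Suc i)"
  shows "chain_between A (N n) (card {i. i < n \<and> N i \<noteq> N (Suc i)})"
  using assms
proof (induction n)
  case 0
  then show ?case
    using chain_between_0[of "N 0" "N 0"] by (auto intro: chain_between_mono)
next
  case (Suc n)
  have IH: "chain_between A (N n) (card {i. i < n \<and> N i \<noteq> N (Suc i)})"
    using Suc by auto
  show ?case
  proof (cases "N n = N (Suc n)")
    case True
    then have "{i. i < Suc n \<and> N i \<noteq> N (Suc i)} = {i. i < n \<and> N i \<noteq> N (Suc i)}"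
      by (auto simp: less_Suc_eq)
    with IH True show ?thesis by auto
  next
    case False
    then have "{i. i < Suc n \<and> N i \<noteq> N (Suc i)} = insert n {i. i < n \<and> N i \<noteq> N (Suc i)}"
      by (auto simp: less_Suc_eq)
    then have card: "card {i. i < Suc n \<and> N i \<noteq> N (Suc i)}
        = card {i. i < n \<and> N i \<noteq> N (Suc i)} + 1" by simp
    have "N n \<subset> N (Suc n)"
      using False Suc.prems(3)[of n] by auto
    then have "chain_between (N n) (N (Suc n)) 1"
      unfolding chain_between_def using Suc.prems(1)[of n] Suc.prems(1)[of "Suc n"]
      by (intro exI[of _ "\<lambda>i. if i = 0 then N n else N (Suc n)"]) auto
    from chain_between_append[OF IH this] card show ?thesis by simp
  qed
qed

text \<open>Subadditivity of length: the chain is intersected with \<open>B\<close> for the lower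
  part and enlarged by \<open>B\<close> for the upper part, and no step is lost in both.\<close>

lemma chain_between_split:
  assumes chain: "chain_between A C n" and "submodule_on B" "A \<subseteq> B" "B \<subseteq> C" "submodule_on C"
  obtains k l where "n \<le> k + l" "chain_between A B k" "chain_between B C l"
proof -
  obtain N where N: "\<And>i. i \<le> n \<Longrightarrow> submodule_on (N i) \<and> A \<subseteq> N i \<and> N i \<subseteq> C"
    "\<And>i. i < n \<Longrightarrow> N i \<subset> N (Suc i)"
    using chain unfolding chain_between_def by auto
  define P where "P i = N i \<inter> B" for i
  define Q where "Q i = msum (N i) B" for i
  have "chain_between A (P n) (card {i. i < n \<and> P i \<noteq> P (Suc i)})"
    using N assms by (intro chain_between_strict_steps)
      (auto simp: P_def submodule_on_Int, (meson in_mono less_imp_le_nat psubsetE)+)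
  then have k: "chain_between A B (card {i. i < n \<and> P i \<noteq> P (Suc i)})"
    by (rule chain_between_mono) (auto simp: P_def)
  have "chain_between B (Q n) (card {i. i < n \<and> Q i \<noteq> Q (Suc i)})"
  proof (rule chain_between_strict_steps)
    show "submodule_on (Q i)" if "i \<le> n" for i
      using N(1)[OF that] assms by (simp add: Q_def submodule_on_msum)
    show "B \<subseteq> Q 0"
      using N(1)[of 0] msum_upper2 by (auto simp: Q_def)
    show "Q i \<subseteq> Q (Suc i)" if "i < n" for i
      using N(2)[OF that] by (auto simp: Q_def msum_def)
  qed
  then have l: "chain_between B C (card {i. i < n \<and> Q i \<noteq> Q (Suc i)})"
  proof (rule chain_between_mono)
    show "Q n \<subseteq> C"
      using N(1)[of n] assms(4) by (auto simp: Q_def msum_def intro!: submodule_onD(2)[OF assms(5)])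
  qed auto
  \<comment> \<open>Modular law: if neither the intersection with \<open>B\<close> nor the sum with
    \<open>B\<close> grows at step \<open>i\<close>, then \<open>N i\<close> and
    \<open>N (Suc i)\<close> coincide.\<close>
  have "i \<in> {i. i < n \<and> P i \<noteq> P (Suc i)} \<union> {i. i < n \<and> Q i \<noteq> Q (Suc i)}" if "i < n" for i
  proof (rule ccontr)
    assume "\<not> ?thesis"
    then have eq: "P i = P (Suc i)" "Q i = Q (Suc i)" using that by auto
    have "N (Suc i) \<subseteq> N i"
    proof
      fix x assume x: "x \<in> N (Suc i)"
      have sub: "submodule_on (N i)" "submodule_on (N (Suc i))" "N i \<subseteq> N (Suc i)"
        using N(1)[of i] N(1)[of "Suc i"] N(2)[OF that] that by auto
      have "x \<in> Q i"
        using x eq(2) msum_upper1[OF assms(2)] by (auto simp: Q_def)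
      then obtain y b where yb: "x = y + b" "y \<in> N i" "b \<in> B"
        by (auto simp: Q_def msum_def)
      then have "b \<in> P (Suc i)"
        using submodule_onD(5)[OF sub(2) x, of y] sub(3) by (auto simp: P_def)
      then have "b \<in> N i" using eq(1) by (auto simp: P_def)
      then show "x \<in> N i" using yb submodule_onD(2)[OF sub(1)] by auto
    qed
    then show False using N(2)[OF that] by auto
  qed
  then have "{..<n} \<subseteq> {i. i < n \<and> P i \<noteq> P (Suc i)} \<union> {i. i < n \<and> Q i \<noteq> Q (Suc i)}"
    by blast
  then have "card {..<n} \<le> card ({i. i < n \<and> P i \<noteq> P (Suc i)} \<union> {i. i < n \<and> Q i \<noteq> Q (Suc i)})"
    by (intro card_mono) auto
  also have "\<dots> \<le> card {i. i < n \<and> P i \<noteq> P (Suc i)} + card {i. i < n \<and> Q i \<noteq> Q (Suc i)}"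
    by (rule card_Un_le)
  finally show thesis using that k l by auto
qed

section \<open>Upper bounds for lengths\<close>

definition length_le :: "'k set \<Rightarrow> 'k set \<Rightarrow> nat \<Rightarrow> bool" where
  "length_le A B k \<longleftrightarrow> (\<forall>n. chain_between A B n \<longrightarrow> n \<le> k)"

lemma length_le_trans:
  assumes "length_le A B k" "length_le B C l" "submodule_on B" "A \<subseteq> B" "B \<subseteq> C" "submodule_on C"
  shows "length_le A C (k + l)"
  unfolding length_le_def
proof (intro allI impI)
  fix n assume "chain_between A C n"
  from chain_between_split[OF this assms(3-6)] obtain k' l'
    where "n \<le> k' + l'" "chain_between A B k'" "chain_between B C l'" by metis
  with assms(1,2) show "n \<le> k + l" unfolding length_le_def by fastforce
qed

lemma length_le_mono:
  "length_le A B k \<Longrightarrow> A \<subseteq> A' \<Longrightarrow> B' \<subseteq> B \<Longrightarrow> k \<le> l \<Longrightarrow> length_le A' B' l"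
  unfolding length_le_def using chain_between_mono[of A' B' _ A B] by (meson order.trans order_refl)

lemma length_le_0:
  assumes "B \<subseteq> A"
  shows "length_le A B 0"
  unfolding length_le_def
proof (intro allI impI)
  fix n assume "chain_between A B n"
  then obtain N where N: "\<And>i. i \<le> n \<Longrightarrow> A \<subseteq> N i \<and> N i \<subseteq> B" "\<And>i. i < n \<Longrightarrow> N i \<subset> N (Suc i)"
    unfolding chain_between_def by auto
  show "n \<le> 0"
    using N(1)[of 0] N(1)[of 1] N(2)[of 0] assms by (cases n) auto
qed

text \<open>Multiplication by \<open>x\<close> identifies \<open>R/E\<close> with \<open>(xR + A)/A\<close>, where \<open>E\<close> is the colon of \<open>A\<close>
  by \<open>x\<close>.  The two lengths cancel in those of \<open>R/A\<close>, which is why \<open>\<ell>(R/E)\<close> must be finite.\<close>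

lemma length_le_principal:
  assumes sub: "submodule_on A" "submodule_on E" "A \<subseteq> E" "E \<subseteq> R"
    and colon: "\<And>z. z \<in> R \<Longrightarrow> x * z \<in> A \<Longrightarrow> z \<in> E"
    and J: "submodule_on J" "A \<subseteq> J" "x \<in> J" "J \<subseteq> R"
    and AE: "length_le A E s" and ER: "length_le E R l"
  shows "length_le J R s"
  unfolding length_le_def
proof (intro allI impI)
  fix n assume n: "chain_between J R n"
  \<comment> \<open>\<open>L\<close> is the exact length of \<open>R/E\<close>, a maximum that
    exists because \<open>l\<close> bounds all chains. The final cancellation needs the same number
    on both sides.\<close>
  define L where "L = (GREATEST k. chain_between E R k)"
  have bound: "k \<le> l" if "chain_between E R k" for k
    using ER that by (auto simp: length_le_def)
  have L: "chain_between E R L"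
    unfolding L_def using chain_between_0[OF sub(2,4)] bound by (rule GreatestI_nat)
  have "length_le E R L"
    unfolding length_le_def L_def using bound by (auto intro: Greatest_le_nat)
  then have "length_le A R (s + L)"
    using length_le_trans AE sub submodule_on_self by blast
  moreover have "chain_between A J L"
  proof -
    obtain N where N: "\<And>i. i \<le> L \<Longrightarrow> submodule_on (N i) \<and> E \<subseteq> N i \<and> N i \<subseteq> R"
      "\<And>i. i < L \<Longrightarrow> N i \<subset> N (Suc i)"
      using L unfolding chain_between_def by auto
    \<comment> \<open>A longest chain of \<open>R/E\<close> is transported along multiplication by
      \<open>x\<close>; the colon hypothesis keeps its steps strict.\<close>
    define M where "M i = msum ((*) x ` N i) A" for i
    have "submodule_on (M i) \<and> A \<subseteq> M i \<and> M i \<subseteq> J" if "i \<le> L" for i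
    proof (intro conjI)
      show "submodule_on (M i)" "A \<subseteq> M i"
        using N(1)[OF that] sub
        by (auto simp: M_def submodule_on_msum submodule_on_scale
            intro!: msum_upper2[THEN subsetD])
      show "M i \<subseteq> J"
        using N(1)[OF that] J submodule_onD(2,3)[OF J(1)] 
        by (auto simp: M_def msum_def mult.commute[of x] subset_iff)
    qed
    moreover have "M i \<subset> M (Suc i)" if "i < L" for i
    proof -
      have Ni: "submodule_on (N i)" "submodule_on (N (Suc i))" "E \<subseteq> N i" "N (Suc i) \<subseteq> R"
        "N i \<subset> N (Suc i)"
        using N(1)[of i] N(1)[of "Suc i"] N(2)[OF that] that by auto
      obtain z where z: "z \<in> N (Suc i)" "z \<notin> N i" using Ni by auto
      have "x * z \<notin> M i"
      proof
        assume "x * z \<in> M i"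
        then obtain y a where ya: "x * z = x * y + a" "y \<in> N i" "a \<in> A"
          by (auto simp: M_def msum_def)
        then have "x * (z - y) \<in> A" by (simp add: algebra_simps)
        moreover have "z - y \<in> R" using z ya Ni by (intro diff_mem) auto
        ultimately have "z - y \<in> N i" using colon Ni by blast
        then have "(z - y) + y \<in> N i" using ya submodule_onD(2)[OF Ni(1)] by blast
        then show False using z by simp
      qed
      moreover have "x * z \<in> M (Suc i)"
        using z msum_upper1[OF sub(1), of "(*) x ` N (Suc i)"] by (auto simp: M_def)
      moreover have "M i \<subseteq> M (Suc i)" using Ni(5) by (fastforce simp: M_def msum_def)
      ultimately show ?thesis by blast
    qed
    ultimately show ?thesis unfolding chain_between_def by blast
  qed
  ultimately have "L + n \<le> s + L"
    using chain_between_append[OF _ n] unfolding length_le_def by blast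
  then show "n \<le> s" by simp
qed

section \<open>Colength in terms of chains of ideals\<close>

lemma a_coset_eq_iff:
  assumes "submodule_on J"
  shows "J +>\<^bsub>ring_on R\<^esub> r = J +>\<^bsub>ring_on R\<^esub> s \<longleftrightarrow> r - s \<in> J"
proof
  assume "J +>\<^bsub>ring_on R\<^esub> r = J +>\<^bsub>ring_on R\<^esub> s"
  then have "0 + r \<in> (\<lambda>j. j + s) ` J"
    using submodule_onD(1)[OF assms] unfolding a_coset_ring_on by blast
  then show "r - s \<in> J" by auto
next
  assume rs: "r - s \<in> J"
  show "J +>\<^bsub>ring_on R\<^esub> r = J +>\<^bsub>ring_on R\<^esub> s"
    unfolding a_coset_ring_on
  proof safe
    fix j assume "j \<in> J"
    then show "j + r \<in> (\<lambda>j. j + s) ` J" "j + s \<in> (\<lambda>j. j + r) ` J"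
      using submodule_onD(2,5)[OF assms _ rs, of j]
      by (auto intro: rev_image_eqI[of "j + (r - s)"] rev_image_eqI[of "j - (r - s)"])
  qed
qed

text \<open>Correspondence theorem: images and preimages under the quotient map \<open>\<pi>\<close>
  preserve strict inclusions between submodules of \<open>R/J\<close> and submodules of
  \<open>R\<close> containing \<open>J\<close>.\<close>

lemma colength_eq:
  assumes "ideal J (ring_on R)"
  shows "colength (ring_on R) J = Sup {enat n | n. chain_between J R n}"
proof -
  interpret J: ideal J "ring_on R" by fact
  interpret Q: module "ring_on R" "quot_module (ring_on R) J"
    by (rule module_quot_module[OF cring_ring_on assms])
  have J: "submodule_on J" "J \<subseteq> R" using assms by (auto simp: ideal_iff)
  define \<pi> where "\<pi> r = J +>\<^bsub>ring_on R\<^esub> r" for r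
  have \<pi>_hom: "\<pi> \<in> ring_hom (ring_on R) (ring_on R Quot J)"
    using J.rcos_ring_hom by (simp add: \<pi>_def[abs_def])
  have carrier: "carrier (ring_on R Quot J) = \<pi> ` R"
    by (auto simp: FactRing_def A_RCOSETS_def' \<pi>_def)
  have \<pi>_add: "\<pi> r \<oplus>\<^bsub>ring_on R Quot J\<^esub> \<pi> s = \<pi> (r + s)" if "r \<in> R" "s \<in> R" for r s
    using ring_hom_add[OF \<pi>_hom] that by simp
  have \<pi>_smult: "r \<odot>\<^bsub>quot_module (ring_on R) J\<^esub> \<pi> s = \<pi> (r * s)" if "r \<in> R" "s \<in> R" for r s
    using ring_hom_mult[OF \<pi>_hom, of r s] that by (simp add: \<pi>_def)
  have \<pi>_0: "\<zero>\<^bsub>ring_on R Quot J\<^esub> = \<pi> 0"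
    by (simp add: FactRing_def \<pi>_def a_coset_ring_on)
  have \<pi>_eq: "\<pi> r = \<pi> s \<longleftrightarrow> r - s \<in> J" for r s
    unfolding \<pi>_def using a_coset_eq_iff[OF J(1)] .
  have sub_image: "submodule (\<pi> ` N) (ring_on R) (quot_module (ring_on R) J)"
    if N: "submodule_on N" "N \<subseteq> R" for N
  proof (rule Q.submoduleI)
    fix a assume "a \<in> \<pi> ` N"
    then obtain x where x: "a = \<pi> x" "x \<in> N" by auto
    then have "\<pi> (- x) \<oplus>\<^bsub>quot_module (ring_on R) J\<^esub> a = \<zero>\<^bsub>quot_module (ring_on R) J\<^esub>"
      using N uminus_mem by (auto simp: \<pi>_add \<pi>_0)
    then have "\<ominus>\<^bsub>quot_module (ring_on R) J\<^esub> a = \<pi> (- x)"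
      using N x uminus_mem by (intro Q.minus_equality) (auto simp: carrier)
    then show "\<ominus>\<^bsub>quot_module (ring_on R) J\<^esub> a \<in> \<pi> ` N"
      using x N submodule_onD(4) by auto
  next
    fix a b assume "a \<in> \<pi> ` N" "b \<in> \<pi> ` N"
    then obtain x y where "a = \<pi> x" "x \<in> N" "b = \<pi> y" "y \<in> N" by auto
    then show "a \<oplus>\<^bsub>quot_module (ring_on R) J\<^esub> b \<in> \<pi> ` N"
      using N submodule_onD(2)[OF N(1), of x y] \<pi>_add[of x y] by auto
  next
    fix r a assume "r \<in> carrier (ring_on R)" "a \<in> \<pi> ` N"
    then obtain x where "a = \<pi> x" "x \<in> N" "r \<in> R" by auto
    then show "r \<odot>\<^bsub>quot_module (ring_on R) J\<^esub> a \<in> \<pi> ` N"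
      using N submodule_onD(3)[OF N(1), of r x] \<pi>_smult[of r x] by (auto simp del: quot_module_simps)
  qed (use N submodule_onD(1) in \<open>auto simp: \<pi>_0 carrier\<close>)
  have "(\<exists>N. (\<forall>i\<le>n. submodule (N i) (ring_on R) (quot_module (ring_on R) J)) \<and>
      (\<forall>i<n. N i \<subset> N (Suc i))) \<longleftrightarrow> chain_between J R n" for n
  proof
    assume "chain_between J R n"
    then obtain N where N: "\<And>i. i \<le> n \<Longrightarrow> submodule_on (N i) \<and> J \<subseteq> N i \<and> N i \<subseteq> R"
      "\<And>i. i < n \<Longrightarrow> N i \<subset> N (Suc i)"
      unfolding chain_between_def by auto
    have "\<pi> ` N i \<subset> \<pi> ` N (Suc i)" if i: "i < n" for i
    proof -
      obtain z where z: "z \<in> N (Suc i)" "z \<notin> N i" using N(2)[OF i] by auto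
      have "\<pi> z \<notin> \<pi> ` N i"
      proof
        assume "\<pi> z \<in> \<pi> ` N i"
        then obtain y where "y \<in> N i" "z - y \<in> J" by (auto simp: \<pi>_eq)
        then have "(z - y) + y \<in> N i"
          using N(1)[of i] i submodule_onD(2) by (meson less_imp_le_nat subsetD)
        then show False using z by simp
      qed
      then show ?thesis using N(2)[OF i] z by auto
    qed
    then show "\<exists>N. (\<forall>i\<le>n. submodule (N i) (ring_on R) (quot_module (ring_on R) J)) \<and>
      (\<forall>i<n. N i \<subset> N (Suc i))"
      using sub_image N(1) by (intro exI[of _ "\<lambda>i. \<pi> ` N i"]) auto
  next
    assume "\<exists>N. (\<forall>i\<le>n. submodule (N i) (ring_on R) (quot_module (ring_on R) J)) \<and>
      (\<forall>i<n. N i \<subset> N (Suc i))"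
    then obtain N where N: "\<And>i. i \<le> n \<Longrightarrow> submodule (N i) (ring_on R) (quot_module (ring_on R) J)"
      "\<And>i. i < n \<Longrightarrow> N i \<subset> N (Suc i)" by auto
    define M where "M i = {r \<in> R. \<pi> r \<in> N i}" for i
    have zero: "\<pi> 0 \<in> N i" if "i \<le> n" for i
      using subgroup.one_closed[OF submodule.axioms(1)[OF N(1)[OF that]]] by (simp add: \<pi>_0)
    have "submodule_on (M i) \<and> J \<subseteq> M i \<and> M i \<subseteq> R" if i: "i \<le> n" for i
    proof (intro conjI submodule_onI)
      fix x y assume "x \<in> M i" "y \<in> M i"
      then show "x + y \<in> M i"
        using Q.submoduleE(5)[OF N(1)[OF i], of "\<pi> x" "\<pi> y"] by (auto simp: M_def \<pi>_add add_mem)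
    next
      fix r x assume "r \<in> R" "x \<in> M i"
      then show "r * x \<in> M i"
        using Q.submoduleE(4)[OF N(1)[OF i], of r "\<pi> x"] \<pi>_smult[of r x]
        by (auto simp: M_def mult_mem simp del: quot_module_simps)
    next
      show "J \<subseteq> M i"
      proof
        fix x assume "x \<in> J"
        then have "\<pi> x = \<pi> 0" by (simp add: \<pi>_eq)
        then show "x \<in> M i" using zero[OF i] \<open>x \<in> J\<close> J by (auto simp: M_def)
      qed
    qed (use zero[OF i] in \<open>auto simp: M_def zero_mem\<close>)
    moreover have "M i \<subset> M (Suc i)" if i: "i < n" for i
    proof -
      obtain z where z: "z \<in> N (Suc i)" "z \<notin> N i" using N(2)[OF i] by auto
      then have "z \<in> \<pi> ` R"
        using Q.submoduleE(1)[OF N(1)[of "Suc i"]] i carrier by auto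
      then show ?thesis using z N(2)[OF i] by (auto simp: M_def)
    qed
    ultimately show "chain_between J R n"
      unfolding chain_between_def by blast
  qed
  then show ?thesis
    unfolding colength_def module_length_def by simp
qed

lemma colength_ge:
  "ideal J (ring_on R) \<Longrightarrow> chain_between J R n \<Longrightarrow> enat n \<le> colength (ring_on R) J"
  by (auto simp: colength_eq intro!: Sup_upper)

lemma colength_le:
  "ideal J (ring_on R) \<Longrightarrow> length_le J R n \<Longrightarrow> colength (ring_on R) J \<le> enat n"
  by (auto simp: colength_eq length_le_def intro!: Sup_least)

end

section \<open>Powers and Frobenius powers of ideals\<close>

sublocale noetherian_local_domain \<subseteq> subring_on R
proof -
  interpret noetherian_domain "ring_on R" by (rule noetherian)
  \<comment> \<open>Closure is known only for the negation of the abstract ring, so this is first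
    identified with negation in the field.\<close>
  have minus: "\<ominus>\<^bsub>ring_on R\<^esub> y = - y" if "y \<in> R" for y
    using l_neg[of y] that by (simp add: eq_neg_iff_add_eq_0)
  show "subring_on R"
  proof
    show "1 \<in> R" using one_closed by simp
    show "x - y \<in> R" if "x \<in> R" "y \<in> R" for x y
      using a_closed[of x "\<ominus>\<^bsub>ring_on R\<^esub> y"] a_inv_closed[of y] that by (simp add: minus)
    show "x * y \<in> R" if "x \<in> R" "y \<in> R" for x y
      using m_closed[of x y] that by simp
  qed
qed

context noetherian_local_domain
begin

lemma ideal_maximal: "ideal \<mm> (ring_on R)"
  by (rule maximalideal.axioms(1)[OF maximal])

lemma maximal_subset: "\<mm> \<subseteq> R" and submodule_maximal: "submodule_on \<mm>"
  using ideal_maximal by (auto simp: ideal_iff)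

text \<open>Otherwise \<open>r\<close> generates a proper ideal, and a maximal ideal above it
  contains \<open>r\<close> and so differs from \<open>\<mm>\<close>, against uniqueness.\<close>

lemma inverse_mem:
  assumes "r \<in> R" "r \<notin> \<mm>"
  shows "inverse r \<in> R"
proof (rule ccontr)
  assume inv: "inverse r \<notin> R"
  interpret noetherian_domain "ring_on R" by (rule noetherian)
  have "r \<noteq> 0" using assms submodule_onD(1)[OF submodule_maximal] by auto
  define S where "S = {I. ideal I (ring_on R) \<and> r \<in> I \<and> 1 \<notin> I}"
  have "submodule_on ((*) r ` R)" by (rule submodule_on_scale[OF submodule_on_self])
  moreover have "(*) r ` R \<subseteq> R" using mult_mem assms by auto
  moreover have "1 \<notin> (*) r ` R"
  proof
    assume "1 \<in> (*) r ` R"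
    then obtain s where "s \<in> R" "1 = r * s" by auto
    then show False using inv \<open>r \<noteq> 0\<close> by (auto simp: inverse_unique)
  qed
  moreover have "r \<in> (*) r ` R" using one_mem by force
  ultimately have S: "(*) r ` R \<in> S" by (auto simp: S_def ideal_iff)
  have "\<exists>M\<in>S. \<forall>Q\<in>S. M \<subseteq> Q \<longrightarrow> Q = M"
  proof (rule subset_Zorn)
    fix C assume C: "subset.chain S C"
    show "\<exists>U\<in>S. \<forall>Q\<in>C. Q \<subseteq> U"
    proof (cases "C = {}")
      case False
      have "subset.chain {I. ideal I (ring_on R)} C"
        using C by (auto simp: subset.chain_def S_def)
      \<comment> \<open>In a Noetherian ring a nonempty chain of ideals contains its own
        union.\<close>
      then have "\<Union>C \<in> C" using ideal_chain_is_trivial False by blast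
      then show ?thesis using C by (auto simp: subset.chain_def)
    qed (use S in auto)
  qed
  then obtain M where M: "M \<in> S" "\<And>Q. Q \<in> S \<Longrightarrow> M \<subseteq> Q \<Longrightarrow> Q = M" by blast
  have "maximalideal M (ring_on R)"
  proof (rule maximalidealI)
    show "ideal M (ring_on R)" "carrier (ring_on R) \<noteq> M"
      using M(1) one_mem by (auto simp: S_def)
    fix Q assume Q: "ideal Q (ring_on R)" "M \<subseteq> Q" "Q \<subseteq> carrier (ring_on R)"
    show "Q = M \<or> Q = carrier (ring_on R)"
    proof (cases "1 \<in> Q")
      case True
      then show ?thesis using ideal.one_imp_carrier[OF Q(1)] by simp
    next
      case False
      then show ?thesis using M Q by (auto simp: S_def)
    qed
  qed
  then show False using unique_maximal M(1) assms(2) by (auto simp: S_def)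
qed

section \<open>Ordinary powers of ideals\<close>

lemma ideal_power_0: "ideal_power (ring_on R) I 0 = R"
  by (simp add: ideal_power_def ideals_set_def)

lemma ideal_power_Suc:
  "ideal_power (ring_on R) I (Suc n) = ideal_prod (ring_on R) (ideal_power (ring_on R) I n) I"
  by (simp add: ideal_power_def ideals_set_def)

lemma ideal_ideal_power:
  assumes "ideal I (ring_on R)"
  shows "ideal (ideal_power (ring_on R) I n) (ring_on R)"
proof (induction n)
  case 0
  then show ?case using cr.oneideal by (simp add: ideal_power_0)
next
  case (Suc n)
  then show ?case using assms by (simp add: ideal_power_Suc cr.ideal_prod_is_ideal)
qed

lemma ideal_power_antimono:
  assumes "ideal I (ring_on R)" "k \<le> n"
  shows "ideal_power (ring_on R) I n \<subseteq> ideal_power (ring_on R) I k"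
  using assms(2)
proof (induction n rule: dec_induct)
  case (step n)
  have "ideal_power (ring_on R) I (Suc n) \<subseteq> ideal_power (ring_on R) I n"
    using cr.ideal_prod_inter[OF ideal_ideal_power[OF assms(1)] assms(1)]
    by (auto simp: ideal_power_Suc)
  with step show ?case by blast
qed auto

lemma power_mem_ideal_power:
  assumes "x \<in> I"
  shows "x ^ n \<in> ideal_power (ring_on R) I n"
proof (induction n)
  case (Suc n)
  then show ?case
    using ideal_prod.prod[OF Suc assms, of "ring_on R"] by (simp add: ideal_power_Suc mult.commute)
qed (simp add: ideal_power_0 one_mem)

text \<open>Products of elements of \<open>I\<close> expand into multiples of monomials in the
  generators. \<open>K\<close> is arbitrary because the induction passes from \<open>K\<close> to
  its colon by a generator.\<close>

lemma ideal_power_subset_of_monomials: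
  assumes "ideal I (ring_on R)" "I = genideal (ring_on R) Y" "Y \<subseteq> R"
    and "ideal K (ring_on R)"
    and "\<And>M. set_mset M \<subseteq> Y \<Longrightarrow> size M = n \<Longrightarrow> prod_mset M \<in> K"
  shows "ideal_power (ring_on R) I n \<subseteq> K"
  using assms(4,5)
proof (induction n arbitrary: K)
  case 0
  from 0(2)[of "{#}"] have "1 \<in> K" by simp
  then show ?case using ideal.one_imp_carrier[OF 0(1)] by (simp add: ideal_power_0)
next
  case (Suc n)
  have K: "submodule_on K" "K \<subseteq> R" using Suc.prems(1) by (auto simp: ideal_iff)
  have ideal_colon: "ideal {z \<in> R. z * w \<in> K} (ring_on R)" for w
    using submodule_onD[OF K(1)]
    by (auto simp: ideal_iff zero_mem add_mem mult_mem distrib_right mult.assoc intro!: submodule_onI)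
  have mult: "w * z \<in> K" if w: "w \<in> ideal_power (ring_on R) I n" and z: "z \<in> I" for w z
  proof -
    have "y * w \<in> K" if y: "y \<in> Y" for y
    proof -
      have "ideal_power (ring_on R) I n \<subseteq> {z \<in> R. z * y \<in> K}"
      proof (rule Suc.IH[OF ideal_colon])
        fix M assume M: "set_mset M \<subseteq> Y" "size M = n"
        have "prod_mset M \<in> R"
          using M(1) assms(3) by (induction M) (auto simp: one_mem mult_mem)
        moreover have "prod_mset (add_mset y M) \<in> K"
          using M y by (intro Suc.prems(2)) auto
        ultimately show "prod_mset M \<in> {z \<in> R. z * y \<in> K}"
          by (simp add: mult.commute)
      qed
      with w show ?thesis by (auto simp: mult.commute)
    qed
    \<comment> \<open>The colon of \<open>K\<close> by \<open>w\<close> contains every generator,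
      hence all of \<open>I\<close>.\<close>
    then have "genideal (ring_on R) Y \<subseteq> {z \<in> R. z * w \<in> K}"
      using assms(3) by (intro cr.genideal_minimal ideal_colon) auto
    with z show ?thesis unfolding assms(2)[symmetric] by (auto simp: mult.commute)
  qed
  show ?case
  proof
    fix x assume "x \<in> ideal_power (ring_on R) I (Suc n)"
    then show "x \<in> K"
      unfolding ideal_power_Suc
      by (induction rule: ideal_prod.induct) (auto simp: mult submodule_onD(2)[OF K(1)])
  qed
qed

section \<open>Frobenius powers\<close>

lemma ideal_frobenius_power:
  assumes "ideal I (ring_on R)"
  shows "ideal (frobenius_power (ring_on R) I q) (ring_on R)"
proof -
  have "I \<subseteq> R" using assms by (simp add: ideal_iff)
  then show ?thesis
    unfolding frobenius_power_def
    by (intro cr.genideal_ideal) (auto simp: nat_pow_ring_on power_mem)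
qed

lemma frobenius_power_subset:
  assumes "ideal I (ring_on R)"
  shows "frobenius_power (ring_on R) I q \<subseteq> ideal_power (ring_on R) I q"
  unfolding frobenius_power_def
  by (intro cr.genideal_minimal ideal_ideal_power assms)
    (auto simp: nat_pow_ring_on power_mem_ideal_power)

text \<open>With \<open>\<mu>\<close> exceeding the number of generators, every monomial of degree \<open>\<mu> q\<close>
  contains a \<open>q\<close>-th power of a generator.\<close>

lemma ideal_power_subset_frobenius_power:
  assumes "ideal I (ring_on R)"
  obtains \<mu> where "\<And>q. q > 0 \<Longrightarrow>
    ideal_power (ring_on R) I (\<mu> * q) \<subseteq> frobenius_power (ring_on R) I q"
proof -
  interpret noetherian_domain "ring_on R" by (rule noetherian)
  obtain Y where Y: "Y \<subseteq> R" "finite Y" "I = genideal (ring_on R) Y"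
    using finetely_gen[OF assms] by auto
  have YI: "Y \<subseteq> I" unfolding Y(3) using Y(1) by (intro cr.genideal_self) simp
  have IR: "I \<subseteq> R" using assms by (simp add: ideal_iff)
  have "ideal_power (ring_on R) I ((card Y + 1) * q) \<subseteq> frobenius_power (ring_on R) I q"
    if "q > 0" for q
  proof (rule ideal_power_subset_of_monomials[OF assms Y(3,1) ideal_frobenius_power[OF assms]])
    fix M assume M: "set_mset M \<subseteq> Y" "size M = (card Y + 1) * q"
    \<comment> \<open>Pigeonhole: multiplicities below \<open>q\<close> would give degree at most
      \<open>card Y * q\<close>, which is less than \<open>(card Y + 1) * q\<close> as
      \<open>q > 0\<close>.\<close>
    have "\<exists>y\<in>set_mset M. q \<le> count M y"
    proof (rule ccontr)
      assume "\<not> ?thesis"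
      then have "size M \<le> (\<Sum>y\<in>set_mset M. q)"
        unfolding size_multiset_overloaded_eq by (intro sum_mono) auto
      also have "\<dots> \<le> card Y * q"
        using card_mono[OF Y(2) M(1)] by simp
      finally show False using M(2) that by simp
    qed
    then obtain y where y: "y \<in> Y" "q \<le> count M y" using M(1) by auto
    then have "replicate_mset q y \<subseteq># M" by (simp add: count_le_replicate_mset_subset_eq)
    then obtain L where L: "M = replicate_mset q y + L" by (auto simp: subset_mset.le_iff_add)
    have "prod_mset L \<in> R"
      using M(1) Y(1) unfolding L by (induction L) (auto simp: one_mem mult_mem split: if_splits)
    moreover have "y ^ q \<in> frobenius_power (ring_on R) I q"
      unfolding frobenius_power_def using y YI IR power_mem
      by (intro subsetD[OF cr.genideal_self]) (auto simp: nat_pow_ring_on)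
    moreover have "submodule_on (frobenius_power (ring_on R) I q)"
      using ideal_frobenius_power[OF assms] by (simp add: ideal_iff)
    ultimately show "prod_mset M \<in> frobenius_power (ring_on R) I q"
      unfolding L using submodule_onD(3) by (simp add: mult.commute)
  qed
  then show thesis using that by blast
qed

end

section \<open>Lattice points in slabs of a cone\<close>

lemma real_vec_simps [simp]:
  "real_vec (u + v) = real_vec u + real_vec v" "real_vec (u - v) = real_vec u - real_vec v"
  "real_vec 0 = 0" "real_vec (int n *s u) = real n *\<^sub>R real_vec u"
  by (simp_all add: real_vec_def vec_eq_iff)

text \<open>The integer vector \<open>u - v\<close> would otherwise be a nontrivial rational
  relation among the components of \<open>a\<close>.\<close>

lemma rationally_independent_inj:
  assumes "rationally_independent a" "real_vec u \<bullet> a = real_vec v \<bullet> a"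
  shows "u = v"
proof -
  have "(\<Sum>i\<in>UNIV. of_rat (of_int (u $ i - v $ i)) * a $ i) = (real_vec u - real_vec v) \<bullet> a"
    by (simp add: inner_vec_def real_vec_def of_rat_diff)
  also have "\<dots> = 0" using assms(2) by (simp add: inner_diff_left)
  finally have "\<forall>i. (of_int (u $ i - v $ i) :: rat) = 0"
    using assms(1)[unfolded rationally_independent_def,
      THEN spec[of _ "\<lambda>i. of_int (u $ i - v $ i)"]] by blast
  then show ?thesis by (simp add: vec_eq_iff)
qed

text \<open>A vanishing component would itself be a rational relation, with a coordinate vector as
  coefficients.\<close>

lemma rationally_independent_nonzero:
  fixes a :: "real ^ 'n::finite"
  assumes "rationally_independent a"
  shows "a $ i \<noteq> 0"
proof
  assume "a $ i = 0"
  then have "(\<Sum>j\<in>UNIV. of_rat (if j = i then 1 else 0) * a $ j) = 0"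
    by (intro sum.neutral) auto
  then have "\<forall>j. (if j = i then 1 else 0 :: rat) = 0"
    using assms[unfolded rationally_independent_def,
      THEN spec[of _ "\<lambda>j. if j = i then 1 else 0"]] by blast
  then show False by (auto dest: spec[of _ i])
qed

text \<open>In a slab of small width, all coordinates but \<open>i\<close> may be chosen freely, after which
  the inner product with \<open>a\<close>, rounded to multiples of \<open>\<bar>a $ i\<bar>\<close>, determines the last one.\<close>

lemma card_lattice_slab:
  fixes a :: "real ^ 'n::finite"
  assumes "0 < c" "0 \<le> t" "s \<le> t" "a $ i \<noteq> 0"
    and cone: "\<And>u. u \<in> U \<Longrightarrow> c * norm (real_vec u) \<le> real_vec u \<bullet> a"
    and slab: "\<And>u. u \<in> U \<Longrightarrow> s \<le> real_vec u \<bullet> a \<and> real_vec u \<bullet> a < t"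
  shows "finite U"
    and "real (card U) \<le> (2 * (t / c) + 1) ^ (CARD('n) - 1) * ((t - s) / \<bar>a $ i\<bar> + 1)"
proof -
  define b where "b = \<lfloor>t / c\<rfloor>"
  define k where "k = \<lfloor>(t - s) / \<bar>a $ i\<bar>\<rfloor>"
  define F where "F u = (restrict (($) u) (UNIV - {i}), \<lfloor>(real_vec u \<bullet> a - s) / \<bar>a $ i\<bar>\<rfloor>)"
    for u :: "int ^ 'n"
  define P where "P = (UNIV - {i} \<rightarrow>\<^sub>E {- b..b}) \<times> {0..k}"
  have b: "0 \<le> b" and k: "0 \<le> k"
    using assms by (auto simp: b_def k_def)
  have "F ` U \<subseteq> P"
  proof (intro image_subsetI)
    fix u assume u: "u \<in> U"
    have "- b \<le> u $ j \<and> u $ j \<le> b" for j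
    proof -
      have "\<bar>real_of_int (u $ j)\<bar> \<le> norm (real_vec u)"
        using component_le_norm_cart[of "real_vec u" j] by (simp add: real_vec_def)
      \<comment> \<open>The cone condition bounds the norm by the height over \<open>c\<close>, so
        all points lie in a box.\<close>
      also have "\<dots> \<le> t / c"
        using cone[OF u] slab[OF u] assms(1) by (simp add: pos_le_divide_eq mult.commute)
      finally have "\<bar>u $ j\<bar> \<le> b" by (simp add: b_def le_floor_iff)
      then show ?thesis by auto
    qed
    moreover have "\<lfloor>(real_vec u \<bullet> a - s) / \<bar>a $ i\<bar>\<rfloor> \<le> k"
      unfolding k_def using slab[OF u] by (intro floor_mono divide_right_mono) auto
    moreover have "0 \<le> \<lfloor>(real_vec u \<bullet> a - s) / \<bar>a $ i\<bar>\<rfloor>"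
      using slab[OF u] by simp
    ultimately show "F u \<in> P" by (auto simp: F_def P_def)
  qed
  moreover have "inj_on F U"
  proof (rule inj_onI)
    fix u v assume "F u = F v"
    then have eq: "restrict (($) u) (UNIV - {i}) = restrict (($) v) (UNIV - {i})"
      and fl: "\<lfloor>(real_vec u \<bullet> a - s) / \<bar>a $ i\<bar>\<rfloor> = \<lfloor>(real_vec v \<bullet> a - s) / \<bar>a $ i\<bar>\<rfloor>"
      by (auto simp: F_def)
    have others: "u $ j = v $ j" if "j \<noteq> i" for j
      using fun_cong[OF eq, of j] that by simp
    have "real_vec u \<bullet> a - real_vec v \<bullet> a = (\<Sum>j\<in>UNIV. real_of_int (u $ j - v $ j) * a $ j)"
      by (simp add: inner_vec_def real_vec_def sum_subtractf left_diff_distrib)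
    also have "\<dots> = (\<Sum>j\<in>{i}. real_of_int (u $ j - v $ j) * a $ j)"
      by (rule sum.mono_neutral_right) (auto simp: others)
    finally have diff: "real_vec u \<bullet> a - real_vec v \<bullet> a = real_of_int (u $ i - v $ i) * a $ i"
      by simp
    \<comment> \<open>Equal roundings make the height difference smaller than
      \<open>\<bar>a $ i\<bar>\<close>, while it is an integer multiple of
      \<open>a $ i\<close>.\<close>
    have "\<bar>(real_vec u \<bullet> a - s) / \<bar>a $ i\<bar> - (real_vec v \<bullet> a - s) / \<bar>a $ i\<bar>\<bar> < 1"
      using fl by linarith
    also have "(real_vec u \<bullet> a - s) / \<bar>a $ i\<bar> - (real_vec v \<bullet> a - s) / \<bar>a $ i\<bar>
        = (real_vec u \<bullet> a - real_vec v \<bullet> a) / \<bar>a $ i\<bar>"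
      by (simp add: diff_divide_distrib)
    finally have "\<bar>real_of_int (u $ i - v $ i)\<bar> < 1"
      using assms(4) unfolding diff by (simp add: abs_mult)
    then have "u $ i = v $ i" by linarith
    with others show "u = v" unfolding vec_eq_iff by metis
  qed
  moreover have "finite P" by (auto simp: P_def intro!: finite_PiE)
  ultimately have "finite U" and "card U \<le> card P"
    by (auto intro: inj_on_finite card_inj_on_le)
  then show "finite U" by simp
  have "card P = nat (2 * b + 1) ^ (CARD('n) - 1) * nat (k + 1)"
    by (simp add: P_def card_cartesian_product card_PiE card_Diff_singleton)
  with \<open>card U \<le> card P\<close>
  have "real (card U) \<le> real (nat (2 * b + 1) ^ (CARD('n) - 1) * nat (k + 1))"
    by (simp only: of_nat_le_iff)
  also have "\<dots> = (2 * real_of_int b + 1) ^ (CARD('n) - 1) * (real_of_int k + 1)"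
    using b k by simp
  also have "\<dots> \<le> (2 * (t / c) + 1) ^ (CARD('n) - 1) * ((t - s) / \<bar>a $ i\<bar> + 1)"
    using b k by (intro mult_mono power_mono add_mono) (auto simp: b_def k_def)
  finally show "real (card U) \<le> (2 * (t / c) + 1) ^ (CARD('n) - 1) * ((t - s) / \<bar>a $ i\<bar> + 1)" .
qed

section \<open>The filtration defined by an OK valuation\<close>

locale ok_valuation = noetherian_local_domain R \<mm>
  for R :: "'k::field set" and \<mm> :: "'k set" +
  fixes a :: "real ^ 'n::finite" and \<nu> :: "'k \<Rightarrow> int ^ 'n"
  assumes indep: "rationally_independent a"
    and OK: "OK_valuation a \<nu> R \<mm>"
begin

text \<open>Since \<open>a\<close> has rationally independent entries, \<open>h\<close> is a real valuation carrying the same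
  information as \<open>\<nu>\<close>.\<close>

definition h :: "'k \<Rightarrow> real" where
  "h x = real_vec (\<nu> x) \<bullet> a"

section \<open>Elementary rules for values\<close>

lemma is_valuation: "is_valuation a \<nu>"
  using OK by (simp add: OK_valuation_def)

lemma \<nu>_mult: "x \<noteq> 0 \<Longrightarrow> y \<noteq> 0 \<Longrightarrow> \<nu> (x * y) = \<nu> x + \<nu> y"
  using is_valuation by (auto simp: is_valuation_def)

lemma \<nu>_one: "\<nu> 1 = 0"
  using \<nu>_mult[of 1 1] by simp

lemma \<nu>_power: "x \<noteq> 0 \<Longrightarrow> real_vec (\<nu> (x ^ n)) = real n *\<^sub>R real_vec (\<nu> x)"
  by (induction n) (simp_all add: \<nu>_one \<nu>_mult scaleR_add_left)

lemma \<nu>_prod: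
  "finite A \<Longrightarrow> (\<And>i. i \<in> A \<Longrightarrow> f i \<noteq> 0) \<Longrightarrow>
    real_vec (\<nu> (\<Prod>i\<in>A. f i)) = (\<Sum>i\<in>A. real_vec (\<nu> (f i)))"
  by (induction A rule: finite_induct) (simp_all add: \<nu>_one \<nu>_mult)

lemma h_mult: "x \<noteq> 0 \<Longrightarrow> y \<noteq> 0 \<Longrightarrow> h (x * y) = h x + h y"
  by (simp add: h_def \<nu>_mult inner_add_left)

lemma h_one: "h 1 = 0"
  by (simp add: h_def \<nu>_one)

lemma h_divide: "x \<noteq> 0 \<Longrightarrow> y \<noteq> 0 \<Longrightarrow> h (x / y) = h x - h y"
  using h_mult[of "x / y" y] by simp

text \<open>\<open>h (- 1)\<close> vanishes because \<open>(- 1) * (- 1) = 1\<close>.\<close>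

lemma h_uminus: "x \<noteq> 0 \<Longrightarrow> h (- x) = h x"
  using h_mult[of "- 1" "- 1"] h_mult[of "- 1" x] by (simp add: h_one)

lemma h_add: "x \<noteq> 0 \<Longrightarrow> y \<noteq> 0 \<Longrightarrow> x + y \<noteq> 0 \<Longrightarrow> h x \<le> h (x + y) \<or> h y \<le> h (x + y)"
  using is_valuation by (auto simp: is_valuation_def vle_def h_def)

lemma h_nonneg: "x \<in> R \<Longrightarrow> x \<noteq> 0 \<Longrightarrow> 0 \<le> h x"
  using OK by (auto simp: OK_valuation_def val_ring_def vle_def h_def)

lemma h_pos: "x \<in> \<mm> \<Longrightarrow> x \<noteq> 0 \<Longrightarrow> 0 < h x"
  using OK by (auto simp: OK_valuation_def val_maximal_def vless_def h_def)

lemma cone: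
  obtains c where "0 < c" "\<And>x. x \<in> R \<Longrightarrow> x \<noteq> 0 \<Longrightarrow> c * norm (real_vec (\<nu> x)) \<le> h x"
proof -
  obtain c where c: "0 < c"
    "closure (convex_cone hull (real_vec ` \<nu> ` (R - {0}))) \<subseteq> {x. x \<bullet> a \<ge> c * norm x}"
    using OK by (auto simp: OK_valuation_def)
  have "real_vec (\<nu> x) \<in> closure (convex_cone hull (real_vec ` \<nu> ` (R - {0})))"
    if "x \<in> R" "x \<noteq> 0" for x
    using that by (intro subsetD[OF closure_subset] hull_inc) auto
  with c show thesis by (intro that[of c]) (auto simp: h_def)
qed

text \<open>One half of the comparison between values and powers of \<open>\<mm>\<close>. Here
  \<open>\<beta>\<close> is the height of the vector \<open>v\<close> of the OK condition, raised to
  at least 1 so as to be positive.\<close>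

lemma ideal_power_contains:
  obtains \<beta> where "0 < \<beta>"
    "\<And>n x. x \<in> R \<Longrightarrow> x \<noteq> 0 \<Longrightarrow> real n * \<beta> \<le> h x \<Longrightarrow> x \<in> ideal_power (ring_on R) \<mm> n"
proof -
  obtain v where v: "\<And>n. R \<inter> val_ge a \<nu> (int n *s v) \<subseteq> ideal_power (ring_on R) \<mm> n"
    using OK by (auto simp: OK_valuation_def)
  define \<beta> where "\<beta> = max 1 (real_vec v \<bullet> a)"
  have "x \<in> ideal_power (ring_on R) \<mm> n" if "x \<in> R" "x \<noteq> 0" "real n * \<beta> \<le> h x" for n x
  proof -
    have "real n * (real_vec v \<bullet> a) \<le> real n * \<beta>"
      by (intro mult_left_mono) (auto simp: \<beta>_def)
    with that have "x \<in> R \<inter> val_ge a \<nu> (int n *s v)"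
      by (auto simp: val_ge_def vle_def h_def)
    with v show ?thesis by blast
  qed
  moreover have "0 < \<beta>" by (simp add: \<beta>_def)
  ultimately show thesis using that by blast
qed

section \<open>The ideals of elements of large value\<close>

text \<open>The guard \<open>x \<noteq> 0\<close> gives \<open>0\<close> infinite value.\<close>

definition Rge :: "real \<Rightarrow> 'k set" where
  "Rge t = {x \<in> R. x \<noteq> 0 \<longrightarrow> t \<le> h x}"

definition Rgt :: "real \<Rightarrow> 'k set" where
  "Rgt t = {x \<in> R. x \<noteq> 0 \<longrightarrow> t < h x}"

lemma submodule_on_Rge: "submodule_on (Rge t)"
proof (rule submodule_onI)
  show "x + y \<in> Rge t" if "x \<in> Rge t" "y \<in> Rge t" for x y
    using that h_add[of x y] by (cases "x = 0"; cases "y = 0") (auto simp: Rge_def add_mem)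
  show "r * x \<in> Rge t" if "r \<in> R" "x \<in> Rge t" for r x
    using that h_nonneg[of r] h_mult[of r x] by (auto simp: Rge_def mult_mem)
qed (auto simp: Rge_def zero_mem)

lemma Rge_subset: "Rge t \<subseteq> R"
  by (auto simp: Rge_def)

lemma Rge_antimono: "s \<le> t \<Longrightarrow> Rge t \<subseteq> Rge s"
  by (auto simp: Rge_def)

lemma Rge_nonpos: "t \<le> 0 \<Longrightarrow> Rge t = R"
  using h_nonneg by (force simp: Rge_def)

text \<open>The other half of the comparison. A nonzero element of \<open>\<mm>\<close> has positive
  height, so its value is a nonzero lattice vector, of norm at least 1; the cone condition then
  makes its height at least \<open>c\<close>.\<close>

lemma ideal_power_subset_Rge:
  obtains c where "0 < c" "\<And>n. ideal_power (ring_on R) \<mm> n \<subseteq> Rge (real n * c)"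
proof -
  obtain c where c: "0 < c" "\<And>x. x \<in> R \<Longrightarrow> x \<noteq> 0 \<Longrightarrow> c * norm (real_vec (\<nu> x)) \<le> h x"
    using cone by metis
  have one_le_norm: "1 \<le> norm (real_vec u)" if u: "u \<noteq> 0" for u :: "int ^ 'n"
  proof -
    obtain i where "u $ i \<noteq> 0" using u by (auto simp: vec_eq_iff)
    then have "1 \<le> \<bar>real_vec u $ i\<bar>" by (simp add: real_vec_def)
    also have "\<dots> \<le> norm (real_vec u)" by (rule component_le_norm_cart)
    finally show ?thesis .
  qed
  have "ideal_power (ring_on R) \<mm> n \<subseteq> Rge (real n * c)" for n
  proof (induction n)
    case 0
    then show ?case by (simp add: ideal_power_0 Rge_nonpos)
  next
    case (Suc n)
    show ?case
    proof
      fix x assume "x \<in> ideal_power (ring_on R) \<mm> (Suc n)"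
      then show "x \<in> Rge (real (Suc n) * c)"
        unfolding ideal_power_Suc
      proof (induction rule: ideal_prod.induct)
        case (prod u v)
        then have u: "u \<in> Rge (real n * c)" and v: "v \<in> \<mm>" using Suc by auto
        then have "v \<in> R" "u \<in> R" using maximal_subset Rge_subset by auto
        moreover have "c \<le> h v" if "v \<noteq> 0"
        proof -
          have "\<nu> v \<noteq> 0" using h_pos[OF v that] by (auto simp: h_def)
          then have "c * 1 \<le> c * norm (real_vec (\<nu> v))"
            using one_le_norm c(1) by (intro mult_left_mono) auto
          also have "\<dots> \<le> h v" using c(2) \<open>v \<in> R\<close> that by blast
          finally show ?thesis by simp
        qed
        ultimately show ?case
          using u h_mult[of u v] by (auto simp: Rge_def mult_mem algebra_simps)
      next
        case (sum u v)
        then show ?case using submodule_onD(2)[OF submodule_on_Rge] by simp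
      qed
    qed
  qed
  with c show thesis using that by blast
qed

section \<open>Lower bound for the colength\<close>

lemma group_closure_values: "group_closure (\<nu> ` (R - {0})) = UNIV"
  using OK by (simp add: OK_valuation_def)

text \<open>The real span contains the group generated by the values, which is the whole lattice and
  includes the standard basis.\<close>

lemma span_values: "span (real_vec ` \<nu> ` (R - {0})) = UNIV"
proof -
  have "real_vec u \<in> span (real_vec ` \<nu> ` (R - {0}))" if "u \<in> group_closure (\<nu> ` (R - {0}))" for u
    using that
  proof (induction rule: group_closure.induct)
    case (base s)
    then show ?case by (auto intro: span_base span_zero)
  next
    case (diff s t)
    then show ?case by (simp add: span_diff)
  qed
  then have "real_vec u \<in> span (real_vec ` \<nu> ` (R - {0}))" for u
    using group_closure_values by auto
  moreover have "axis i 1 = real_vec (axis i 1)" for i :: 'n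
    by (simp add: real_vec_def axis_def vec_eq_iff)
  ultimately have "Basis \<subseteq> span (real_vec ` \<nu> ` (R - {0}))"
    by (auto simp: Basis_vec_def)
  then have "span (Basis :: (real ^ 'n) set) \<subseteq> span (real_vec ` \<nu> ` (R - {0}))"
    by (intro span_minimal) auto
  then show ?thesis by auto
qed

text \<open>An element of height \<open>w\<close> lies in \<open>Rge w\<close> but not in
  \<open>Rge t\<close> for \<open>t > w\<close>, so every value gives a strict step. The induction
  removes the largest value and lowers \<open>t\<close> to its height.\<close>

lemma chain_between_values:
  assumes "finite T" "T \<subseteq> \<nu> ` (R - {0})" "\<And>u. u \<in> T \<Longrightarrow> real_vec u \<bullet> a < t"
  shows "chain_between (Rge t) R (card T)"
  using assms
proof (induction "card T" arbitrary: T t)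
  case 0
  then show ?case using chain_between_0[OF submodule_on_Rge Rge_subset] by simp
next
  case (Suc n)
  define V where "V = (\<lambda>u. real_vec u \<bullet> a) ` T"
  have "T \<noteq> {}" using Suc.hyps(2) by auto
  then have "Max V \<in> V" using Suc.prems by (intro Max_in) (auto simp: V_def)
  then obtain u where u: "u \<in> T" "Max V = real_vec u \<bullet> a" by (auto simp: V_def)
  define w where "w = real_vec u \<bullet> a"
  have "real_vec u' \<bullet> a < w" if "u' \<in> T - {u}" for u'
  proof -
    have "real_vec u' \<bullet> a \<le> w"
      unfolding w_def u(2)[symmetric] using that Suc.prems(1) by (intro Max_ge) (auto simp: V_def)
    moreover have "real_vec u' \<bullet> a \<noteq> w"
      using that rationally_independent_inj[OF indep] unfolding w_def by blast
    ultimately show ?thesis by simp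
  qed
  moreover have "n = card (T - {u})" using Suc.hyps(2) u(1) by simp
  moreover have "T - {u} \<subseteq> \<nu> ` (R - {0})" "finite (T - {u})" using Suc.prems by blast+
  ultimately have IH: "chain_between (Rge w) R n"
    using Suc.hyps(1)[of "T - {u}" w] by blast
  obtain x where x: "x \<in> R" "x \<noteq> 0" "\<nu> x = u" using u(1) Suc.prems(2) by auto
  have "w < t" using u(1) Suc.prems(3) by (simp add: w_def)
  have "Rge t \<subset> Rge w"
  proof
    show "Rge t \<subseteq> Rge w" using \<open>w < t\<close> by (intro Rge_antimono) simp
    have "x \<in> Rge w" "x \<notin> Rge t"
      using x \<open>w < t\<close> by (auto simp: Rge_def h_def w_def)
    then show "Rge t \<noteq> Rge w" by blast
  qed
  then have "chain_between (Rge t) (Rge w) 1"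
    unfolding chain_between_def
    by (intro exI[of _ "\<lambda>i. if i = 0 then Rge t else Rge w"]) (auto simp: submodule_on_Rge)
  from chain_between_append[OF this IH] Suc.hyps(2) show ?case by simp
qed

text \<open>Products of powers of \<open>d\<close> elements with linearly independent values have distinct values,
  so already \<open>j\<^sup>d\<close> of the values below \<open>jH\<close> are visible in the colength.\<close>

lemma chain_between_pow:
  obtains H where "0 < H" "\<And>j. chain_between (Rge (real j * H)) R (j ^ CARD('n))"
proof -
  obtain B where B: "B \<subseteq> real_vec ` \<nu> ` (R - {0})" "independent B"
    "real_vec ` \<nu> ` (R - {0}) \<subseteq> span B" "card B = dim (real_vec ` \<nu> ` (R - {0}))"
    by (rule basis_exists)
  have "dim (real_vec ` \<nu> ` (R - {0})) = CARD('n)"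
    using span_values by (metis dim_UNIV dim_span DIM_cart DIM_real mult.right_neutral)
  with B have card_B: "card B = CARD('n)" by simp
  have fin_B: "finite B" by (rule independent_imp_finite[OF B(2)])
  have "\<forall>b\<in>B. \<exists>x. x \<in> R \<and> x \<noteq> 0 \<and> real_vec (\<nu> x) = b" using B(1) by auto
  then obtain x where x: "\<And>b. b \<in> B \<Longrightarrow> x b \<in> R" "\<And>b. b \<in> B \<Longrightarrow> x b \<noteq> 0"
    "\<And>b. b \<in> B \<Longrightarrow> real_vec (\<nu> (x b)) = b" by metis
  have b_nonneg: "0 \<le> b \<bullet> a" if "b \<in> B" for b
    using h_nonneg x that unfolding h_def by metis
  \<comment> \<open>The summand 1 makes \<open>H\<close> positive and the last estimate
    strict.\<close>
  define H where "H = 1 + (\<Sum>b\<in>B. b \<bullet> a)"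
  have "0 < H" using b_nonneg by (auto simp: H_def intro!: add_pos_nonneg sum_nonneg)
  moreover have "chain_between (Rge (real j * H)) R (j ^ CARD('n))" for j
  proof (cases "j = 0")
    case True
    then show ?thesis
      using chain_between_0[OF submodule_on_Rge Rge_subset] by (simp add: zero_power)
  next
    case False
    define G where "G = B \<rightarrow>\<^sub>E {..<j}"
    define m where "m g = (\<Prod>b\<in>B. x b ^ g b)" for g
    have m: "m g \<in> R" "m g \<noteq> 0" for g
    proof -
      have "finite A \<Longrightarrow> A \<subseteq> B \<Longrightarrow> (\<Prod>b\<in>A. x b ^ g b) \<in> R" for A
        by (induction A rule: finite_induct) (auto simp: one_mem mult_mem power_mem x)
      then show "m g \<in> R" using fin_B by (simp add: m_def)
      show "m g \<noteq> 0" using fin_B x by (simp add: m_def)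
    qed
    have \<nu>_m: "real_vec (\<nu> (m g)) = (\<Sum>b\<in>B. real (g b) *\<^sub>R b)" for g
      unfolding m_def using fin_B x by (simp add: \<nu>_prod \<nu>_power)
    \<comment> \<open>Linear independence of \<open>B\<close> recovers the exponents from the
      value.\<close>
    have "inj_on (\<lambda>g. \<nu> (m g)) G"
    proof (rule inj_onI)
      fix g g' assume g: "g \<in> G" "g' \<in> G" "\<nu> (m g) = \<nu> (m g')"
      then have "(\<Sum>b\<in>B. real (g b) *\<^sub>R b) = (\<Sum>b\<in>B. real (g' b) *\<^sub>R b)"
        using \<nu>_m by metis
      then have "(\<Sum>b\<in>B. (real (g b) - real (g' b)) *\<^sub>R b) = 0"
        by (simp add: scaleR_diff_left sum_subtractf)
      then have "g b = g' b" if "b \<in> B" for b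
        using independentD[OF B(2) fin_B subset_refl _ that] by force
      then show "g = g'" using g(1,2) unfolding G_def by (auto intro: PiE_ext)
    qed
    then have "card ((\<lambda>g. \<nu> (m g)) ` G) = j ^ CARD('n)"
      using fin_B by (simp add: card_image G_def card_PiE card_B)
    moreover have "chain_between (Rge (real j * H)) R (card ((\<lambda>g. \<nu> (m g)) ` G))"
    proof (rule chain_between_values)
      show "finite ((\<lambda>g. \<nu> (m g)) ` G)"
        using fin_B by (auto simp: G_def intro: finite_PiE)
      show "(\<lambda>g. \<nu> (m g)) ` G \<subseteq> \<nu> ` (R - {0})" using m by auto
      fix u assume "u \<in> (\<lambda>g. \<nu> (m g)) ` G"
      then obtain g where g: "g \<in> G" "u = \<nu> (m g)" by auto
      then have gb: "g b < j" if "b \<in> B" for b using that by (auto simp: G_def PiE_iff)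
      have "real_vec u \<bullet> a = (\<Sum>b\<in>B. real (g b) * (b \<bullet> a))"
        by (simp add: g(2) \<nu>_m inner_sum_left)
      also have "\<dots> \<le> (\<Sum>b\<in>B. real j * (b \<bullet> a))"
        using gb b_nonneg by (intro sum_mono mult_right_mono) (auto simp: less_imp_le)
      also have "\<dots> < real j * H"
        using False by (simp add: H_def sum_distrib_left[symmetric] distrib_left)
      finally show "real_vec u \<bullet> a < real j * H" .
    qed
    ultimately show ?thesis by simp
  qed
  ultimately show thesis using that by blast
qed

text \<open>Carries the bound from \<open>Rge\<close> to powers of \<open>\<mm>\<close>, using
  \<open>H \<le> K c\<close>. All large \<open>K\<close> are allowed, since in characteristic
  \<open>p\<close> a power of \<open>p\<close> will be chosen.\<close>

lemma colength_ge_pow: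
  obtains K\<^sub>0 where "\<And>K j J. K\<^sub>0 \<le> K \<Longrightarrow> ideal J (ring_on R) \<Longrightarrow>
    J \<subseteq> ideal_power (ring_on R) \<mm> (K * j) \<Longrightarrow> enat (j ^ CARD('n)) \<le> colength (ring_on R) J"
proof -
  obtain H where H: "0 < H" "\<And>j. chain_between (Rge (real j * H)) R (j ^ CARD('n))"
    using chain_between_pow by metis
  obtain c where c: "0 < c" "\<And>n. ideal_power (ring_on R) \<mm> n \<subseteq> Rge (real n * c)"
    using ideal_power_subset_Rge by metis
  obtain K\<^sub>0 :: nat where K\<^sub>0: "H / c \<le> real K\<^sub>0" using real_arch_simple by blast
  have "enat (j ^ CARD('n)) \<le> colength (ring_on R) J"
    if "K\<^sub>0 \<le> K" "ideal J (ring_on R)" "J \<subseteq> ideal_power (ring_on R) \<mm> (K * j)" for K j J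
  proof (rule colength_ge[OF that(2)])
    have "H \<le> real K * c"
      using K\<^sub>0 that(1) c(1) by (meson of_nat_le_iff order.trans pos_divide_le_eq)
    then have "real j * H \<le> real (K * j) * c"
      using mult_left_mono[of H "real K * c" "real j"] by (simp add: algebra_simps)
    then have "J \<subseteq> Rge (real j * H)" using that(3) c(2) Rge_antimono by blast
    then show "chain_between J R (j ^ CARD('n))"
      using chain_between_mono[OF H(2)] by blast
  qed
  then show thesis using that by blast
qed

section \<open>The valuation ring and the graded pieces of the filtration\<close>

lemma subring_val_ring: "subring_on (val_ring a \<nu>)"
proof
  show "1 \<in> val_ring a \<nu>" by (simp add: val_ring_def vle_def \<nu>_one)
  show "x - y \<in> val_ring a \<nu>" if "x \<in> val_ring a \<nu>" "y \<in> val_ring a \<nu>" for x y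
    using that h_add[of x "- y"] h_uminus[of y]
    by (cases "x = 0"; cases "y = 0") (auto simp: val_ring_def vle_def h_def)
  show "x * y \<in> val_ring a \<nu>" if "x \<in> val_ring a \<nu>" "y \<in> val_ring a \<nu>" for x y
    using that by (auto simp: val_ring_def vle_def \<nu>_mult inner_add_left)
qed

lemma mem_val_ring: "x \<in> val_ring a \<nu> \<longleftrightarrow> (x \<noteq> 0 \<longrightarrow> 0 \<le> h x)"
  by (auto simp: val_ring_def vle_def h_def)

lemma mem_val_maximal: "x \<in> val_maximal a \<nu> \<longleftrightarrow> (x \<noteq> 0 \<longrightarrow> 0 < h x)"
  by (auto simp: val_maximal_def vless_def h_def)

lemma submodule_val_maximal: "subring_on.submodule_on (val_ring a \<nu>) (val_maximal a \<nu>)"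
proof -
  interpret V: subring_on "val_ring a \<nu>" by (rule subring_val_ring)
  show ?thesis
  proof (rule V.submodule_onI)
    show "x + y \<in> val_maximal a \<nu>" if "x \<in> val_maximal a \<nu>" "y \<in> val_maximal a \<nu>" for x y
      using that h_add[of x y] by (cases "x = 0"; cases "y = 0") (auto simp: mem_val_maximal)
    show "r * x \<in> val_maximal a \<nu>" if "r \<in> val_ring a \<nu>" "x \<in> val_maximal a \<nu>" for r x
      using that by (auto simp: mem_val_maximal mem_val_ring h_mult)
  qed (simp add: mem_val_maximal)
qed

text \<open>Dividing by an element of value \<open>w\<close> embeds the graded piece \<open>Rge w / Rgt w\<close> into the
  residue field of the valuation, which is finite over that of \<open>R\<close>.\<close>

lemma length_le_graded_piece:
  obtains f where "\<And>w. length_le (Rgt w) (Rge w) f"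
proof -
  interpret V: subring_on "val_ring a \<nu>" by (rule subring_val_ring)
  define M where "M = val_maximal a \<nu>"
  have M: "V.submodule_on M" "M \<subseteq> val_ring a \<nu>"
    using submodule_val_maximal by (auto simp: M_def mem_val_maximal mem_val_ring)
  interpret M: ideal M "ring_on (val_ring a \<nu>)" using M by (simp add: V.ideal_iff)
  define F where "F = val_residue_field a \<nu>"
  have F: "F = ring_on (val_ring a \<nu>) Quot M" by (simp add: F_def M_def val_residue_field_def)
  interpret F: cring F unfolding F by (rule M.quotient_is_cring[OF V.cring_ring_on])
  define \<phi> where "\<phi> v = M +>\<^bsub>ring_on (val_ring a \<nu>)\<^esub> v" for v
  have \<phi>_hom: "\<phi> \<in> ring_hom (ring_on (val_ring a \<nu>)) F"
    using M.rcos_ring_hom by (simp add: \<phi>_def[abs_def] F)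
  interpret \<phi>: ring_hom_ring "ring_on (val_ring a \<nu>)" F \<phi>
    using \<phi>_hom V.cr.ring_axioms F.ring_axioms by (intro ring_hom_ringI2)
  have carrier_F: "carrier F = \<phi> ` val_ring a \<nu>"
    by (auto simp: F FactRing_def A_RCOSETS_def' \<phi>_def)
  have \<phi>_eq: "\<phi> u = \<phi> v \<longleftrightarrow> u - v \<in> M" for u v
    unfolding \<phi>_def using V.a_coset_eq_iff[OF M(1)] .
  have \<phi>_mult: "\<phi> (u * v) = \<phi> u \<otimes>\<^bsub>F\<^esub> \<phi> v" if "u \<in> val_ring a \<nu>" "v \<in> val_ring a \<nu>" for u v
    using \<phi>.hom_mult[of u v] that by simp
  have \<phi>_add: "\<phi> (u + v) = \<phi> u \<oplus>\<^bsub>F\<^esub> \<phi> v" if "u \<in> val_ring a \<nu>" "v \<in> val_ring a \<nu>" for u v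
    using \<phi>.hom_add[of u v] that by simp
  have \<phi>_one: "\<phi> 1 = \<one>\<^bsub>F\<^esub>" and \<phi>_zero: "\<phi> 0 = \<zero>\<^bsub>F\<^esub>"
    using \<phi>.hom_one \<phi>.hom_zero by simp_all
  have RV: "R \<subseteq> val_ring a \<nu>" using OK by (simp add: OK_valuation_def)
  have inverse: "\<phi> u \<otimes>\<^bsub>F\<^esub> \<phi> (inverse u) = \<one>\<^bsub>F\<^esub>"
    if "u \<in> val_ring a \<nu>" "inverse u \<in> val_ring a \<nu>" "u \<noteq> 0" for u
    using \<phi>_mult[OF that(1,2)] that(3) by (simp add: \<phi>_one)
  \<comment> \<open>An element of the valuation ring outside \<open>M\<close> has height 0, so its
    inverse stays in the valuation ring.\<close>
  interpret F: field F
  proof (rule F.cring_fieldI2)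
    show "\<zero>\<^bsub>F\<^esub> \<noteq> \<one>\<^bsub>F\<^esub>"
      unfolding \<phi>_one[symmetric] \<phi>_zero[symmetric] \<phi>_eq
      using h_uminus[of 1] by (simp add: M_def mem_val_maximal h_one)
    fix k assume "k \<in> carrier F" "k \<noteq> \<zero>\<^bsub>F\<^esub>"
    then obtain u where u: "k = \<phi> u" "u \<in> val_ring a \<nu>" "u \<notin> M"
      using \<phi>_eq[of _ 0] by (auto simp: carrier_F \<phi>_zero)
    then have "u \<noteq> 0" "h u = 0" by (auto simp: M_def mem_val_maximal mem_val_ring)
    then have "inverse u \<in> val_ring a \<nu>"
      using h_divide[of 1 u] by (simp add: mem_val_ring inverse_eq_divide h_one)
    then show "\<exists>b\<in>carrier F. k \<otimes>\<^bsub>F\<^esub> b = \<one>\<^bsub>F\<^esub>"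
      using inverse[OF u(2)] \<open>u \<noteq> 0\<close> by (auto simp: carrier_F u(1))
  qed
  \<comment> \<open>The copy of \<open>R/\<mm>\<close> in the residue field. It is a subfield
    because elements of \<open>R\<close> outside \<open>M\<close> lie outside \<open>\<mm>\<close>
    and are therefore units of \<open>R\<close>.\<close>
  define K where "K = \<phi> ` R"
  have K: "subfield K F"
  proof (rule F.subfieldI')
    have "subring R (ring_on (val_ring a \<nu>))"
    proof (rule V.cr.subringI)
      fix x assume x: "x \<in> R"
      then have "\<ominus>\<^bsub>ring_on (val_ring a \<nu>)\<^esub> x = - x"
        using RV uminus_mem by (intro V.cr.minus_equality) auto
      then show "\<ominus>\<^bsub>ring_on (val_ring a \<nu>)\<^esub> x \<in> R" using x uminus_mem by simp
    qed (use RV one_mem add_mem mult_mem in auto)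
    then show "subring K F" unfolding K_def by (rule \<phi>.img_is_subring)
    fix k assume "k \<in> K - {\<zero>\<^bsub>F\<^esub>}"
    then obtain r where r: "k = \<phi> r" "r \<in> R" "r \<notin> M"
      using \<phi>_eq[of _ 0] by (auto simp: K_def \<phi>_zero)
    moreover have "\<mm> \<subseteq> M" using OK by (simp add: OK_valuation_def M_def)
    ultimately have "r \<notin> \<mm>" by blast
    then have inv: "inverse r \<in> R" "r \<noteq> 0"
      using inverse_mem r submodule_onD(1)[OF submodule_maximal] by auto
    then have "\<phi> (inverse r) = inv\<^bsub>F\<^esub> k"
      unfolding r(1) using inverse[of r] r(2) RV \<phi>.hom_closed
      by (intro F.comm_inv_char[symmetric]) auto
    then show "inv\<^bsub>F\<^esub> k \<in> K" using inv(1) by (auto simp: K_def)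
  qed
  have "residue_image a \<nu> R = K"
    by (simp add: residue_image_def K_def \<phi>_def M_def)
  then have "F.finite_dimension K (carrier F)"
    using OK by (simp add: OK_valuation_def F_def)
  then obtain f where f: "F.dimension f K (carrier F)"
    by (auto simp: F.finite_dimension_def)
  have "length_le (Rgt w) (Rge w) f" for w
    unfolding length_le_def
  proof (intro allI impI)
    fix n assume "chain_between (Rgt w) (Rge w) n"
    then obtain N where N: "\<And>i. i \<le> n \<Longrightarrow> submodule_on (N i) \<and> Rgt w \<subseteq> N i \<and> N i \<subseteq> Rge w"
      "\<And>i. i < n \<Longrightarrow> N i \<subset> N (Suc i)"
      unfolding chain_between_def by auto
    show "n \<le> f"
    proof (cases "n = 0")
      case False
      have "\<exists>x. x \<in> N (Suc i) \<and> x \<notin> N i" if "i < n" for i using N(2)[OF that] by auto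
      then obtain x where x: "\<And>i. i < n \<Longrightarrow> x i \<in> N (Suc i) \<and> x i \<notin> N i" by metis
      \<comment> \<open>Lying in \<open>N 1\<close> but not in \<open>N 0\<close>, this element has
        height exactly \<open>w\<close>, so division by it maps \<open>Rge w\<close> into the
        valuation ring.\<close>
      define y where "y = x 0"
      have y: "y \<in> Rge w" "y \<notin> Rgt w" using x[of 0] N(1)[of 0] N(1)[of 1] False
        by (auto simp: y_def)
      then have y0: "y \<noteq> 0" "h y = w" by (auto simp: Rge_def Rgt_def)
      have div_mem: "z / y \<in> val_ring a \<nu>" if "z \<in> Rge w" for z
        using that y0 by (auto simp: mem_val_ring Rge_def h_divide)
      \<comment> \<open>Each step adds one independent class. Keeping the span inside the image of
        \<open>N k\<close> ensures that the class of \<open>x k\<close> is new.\<close>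
      have "k \<le> n \<Longrightarrow> \<exists>Us. length Us = k \<and> F.independent K Us \<and>
        F.Span K Us \<subseteq> (\<lambda>z. \<phi> (z / y)) ` N k" for k
      proof (induction k)
        case 0
        have "0 \<in> N 0" using N(1)[of 0] submodule_onD(1) by auto
        then have "F.Span K [] \<subseteq> (\<lambda>z. \<phi> (z / y)) ` N 0"
          using \<phi>_zero by force
        then show ?case by (intro exI[of _ "[]"]) auto
      next
        case (Suc k)
        then obtain Us where Us: "length Us = k" "F.independent K Us"
          "F.Span K Us \<subseteq> (\<lambda>z. \<phi> (z / y)) ` N k" by auto
        have Nk: "submodule_on (N k)" "Rgt w \<subseteq> N k" "N k \<subseteq> N (Suc k)"
          "submodule_on (N (Suc k))" "N (Suc k) \<subseteq> Rge w"
          and xk: "x k \<in> N (Suc k)" "x k \<notin> N k"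
          using N(1)[of k] N(1)[of "Suc k"] N(2)[of k] x[of k] Suc.prems by auto
        define u where "u = \<phi> (x k / y)"
        have u: "u \<in> carrier F"
          unfolding u_def carrier_F using div_mem xk Nk by auto
        have "u \<notin> F.Span K Us"
        proof
          assume "u \<in> F.Span K Us"
          then obtain z where z: "z \<in> N k" "\<phi> (x k / y) = \<phi> (z / y)"
            using Us(3) by (auto simp: u_def)
          then have "(x k - z) / y \<in> M" by (simp add: \<phi>_eq diff_divide_distrib)
          moreover have "x k - z \<in> R"
            using submodule_onD(5)[OF Nk(4) xk(1), of z] z(1) Nk Rge_subset by blast
          \<comment> \<open>Equality of classes means that the difference has height above
            \<open>w\<close>, and such elements already belong to \<open>N k\<close>.\<close>
          ultimately have "x k - z \<in> Rgt w"
            using y0 by (auto simp: M_def mem_val_maximal Rgt_def h_divide)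
          then have "(x k - z) + z \<in> N k" using Nk z(1) by (intro submodule_onD(2)) auto
          then show False using xk by simp
        qed
        then have "F.independent K (u # Us)" using u Us(2) by (intro F.li_Cons)
        moreover have "F.Span K (u # Us) \<subseteq> (\<lambda>z. \<phi> (z / y)) ` N (Suc k)"
        proof
          fix s assume "s \<in> F.Span K (u # Us)"
          then obtain r v where rv: "r \<in> K" "v \<in> F.Span K Us" "s = r \<otimes>\<^bsub>F\<^esub> u \<oplus>\<^bsub>F\<^esub> v"
            by (auto simp: F.line_extension_mem_iff)
          then obtain q z where q: "q \<in> R" "r = \<phi> q" and z: "z \<in> N k" "v = \<phi> (z / y)"
            using Us(3) by (auto simp: K_def)
          have "s = \<phi> ((q * x k + z) / y)"
          proof -
            have "x k / y \<in> val_ring a \<nu>" "z / y \<in> val_ring a \<nu>" "q \<in> val_ring a \<nu>"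
              using xk z Nk q RV by (auto intro!: div_mem)
            then show ?thesis
              using \<phi>_mult[of q "x k / y"] \<phi>_add[of "q * (x k / y)" "z / y"]
                V.mult_mem[of q "x k / y"]
              by (simp add: rv(3) q(2) z(2) u_def add_divide_distrib)
          qed
          moreover have "q * x k + z \<in> N (Suc k)"
            using submodule_onD(2,3)[OF Nk(4)] q(1) xk(1) z(1) Nk(3) by blast
          ultimately show "s \<in> (\<lambda>z. \<phi> (z / y)) ` N (Suc k)" by blast
        qed
        ultimately show ?case using Us(1) by (intro exI[of _ "u # Us"]) auto
      qed
      then obtain Us where Us: "length Us = n" "F.independent K Us" by blast
      then show "n \<le> f"
        using F.independent_length_le_dimension[OF K f Us(2)] F.independent_in_carrier by auto
    qed simp
  qed
  then show thesis using that by blast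
qed

section \<open>Upper bound for the colength\<close>

text \<open>Half open to match \<open>Rge s / Rge t\<close>: height \<open>s\<close> counts, height
  \<open>t\<close> no longer does.\<close>

definition slab :: "real \<Rightarrow> real \<Rightarrow> (int ^ 'n) set" where
  "slab s t = {u \<in> \<nu> ` (R - {0}). s \<le> real_vec u \<bullet> a \<and> real_vec u \<bullet> a < t}"

text \<open>The ideals \<open>Rge\<close> change only at heights of values, and each change costs at
  most \<open>f\<close>. The induction removes the largest value of the slab.\<close>

lemma length_le_slab:
  assumes graded: "\<And>w. length_le (Rgt w) (Rge w) f" and "finite (slab s t)"
  shows "length_le (Rge t) (Rge s) (f * card (slab s t))"
  using assms(2)
proof (induction "card (slab s t)" arbitrary: t)
  case 0
  then have "slab s t = {}" by simp
  then have "Rge s \<subseteq> Rge t" by (force simp: slab_def Rge_def h_def)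
  then show ?case using length_le_0 length_le_mono by blast
next
  case (Suc n)
  define V where "V = (\<lambda>u. real_vec u \<bullet> a) ` slab s t"
  have "slab s t \<noteq> {}" using Suc.hyps(2) by auto
  then have "Max V \<in> V" using Suc.prems by (intro Max_in) (auto simp: V_def)
  then obtain u where u: "u \<in> slab s t" "Max V = real_vec u \<bullet> a" by (auto simp: V_def)
  define w where "w = real_vec u \<bullet> a"
  have max: "real_vec u' \<bullet> a \<le> w" if "u' \<in> slab s t" for u'
    unfolding w_def u(2)[symmetric] using that Suc.prems by (intro Max_ge) (auto simp: V_def)
  have w: "s \<le> w" "w < t" using u(1) by (auto simp: slab_def w_def)
  have "slab s w = slab s t - {u}"
  proof
    show "slab s w \<subseteq> slab s t - {u}" using w by (auto simp: slab_def w_def)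
    show "slab s t - {u} \<subseteq> slab s w"
    proof
      fix u' assume u': "u' \<in> slab s t - {u}"
      then have "real_vec u' \<bullet> a \<noteq> w"
        using rationally_independent_inj[OF indep] unfolding w_def by blast
      then show "u' \<in> slab s w" using u' max[of u'] by (auto simp: slab_def)
    qed
  qed
  then have "n = card (slab s w)" "finite (slab s w)"
    using Suc.hyps(2) Suc.prems u(1) by auto
  then have IH: "length_le (Rge w) (Rge s) (f * n)"
    using Suc.hyps(1)[of w] by simp
  \<comment> \<open>By maximality of \<open>w\<close>, no value has height strictly between
    \<open>w\<close> and \<open>t\<close>.\<close>
  have "Rgt w \<subseteq> Rge t"
  proof
    fix x assume x: "x \<in> Rgt w"
    have "t \<le> h x" if "x \<noteq> 0"
    proof (rule ccontr)
      assume "\<not> t \<le> h x"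
      then have "\<nu> x \<in> slab s t" using x w that by (auto simp: slab_def h_def Rgt_def)
      then show False using max[of "\<nu> x"] x that by (auto simp: Rgt_def h_def)
    qed
    then show "x \<in> Rge t" using x by (auto simp: Rge_def Rgt_def)
  qed
  then have "length_le (Rge t) (Rge w) f" using length_le_mono[OF graded] by blast
  then have "length_le (Rge t) (Rge s) (f + f * n)"
    using w by (intro length_le_trans[OF _ IH] submodule_on_Rge Rge_antimono) auto
  then show ?case by (simp flip: Suc.hyps(2))
qed

text \<open>With \<open>t = N \<beta>\<close>, the ideal \<open>J\<close> contains both
  \<open>x\<close> and \<open>Rge t\<close>. Then \<open>length_le_principal\<close> reduces the
  colength to a slab of width \<open>h x\<close>, whose lattice points are counted.\<close>

lemma colength_le_value:
  obtains C where "0 \<le> C" "\<And>J x N. ideal J (ring_on R) \<Longrightarrow> x \<in> J \<Longrightarrow> x \<noteq> 0 \<Longrightarrow> 0 < N \<Longrightarrow>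
    ideal_power (ring_on R) \<mm> N \<subseteq> J \<Longrightarrow>
    \<exists>k. colength (ring_on R) J \<le> enat k \<and> real k \<le> C * (h x + 1) * real N ^ (CARD('n) - 1)"
proof -
  obtain f where graded: "\<And>w. length_le (Rgt w) (Rge w) f" using length_le_graded_piece by metis
  obtain c where c: "0 < c" "\<And>x. x \<in> R \<Longrightarrow> x \<noteq> 0 \<Longrightarrow> c * norm (real_vec (\<nu> x)) \<le> h x"
    using cone by metis
  obtain \<beta> where \<beta>: "0 < \<beta>"
    "\<And>n x. x \<in> R \<Longrightarrow> x \<noteq> 0 \<Longrightarrow> real n * \<beta> \<le> h x \<Longrightarrow> x \<in> ideal_power (ring_on R) \<mm> n"
    using ideal_power_contains by metis
  \<comment> \<open>An arbitrary coordinate, the one left out in the lattice count.\<close>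
  define i :: 'n where "i = undefined"
  have ai: "a $ i \<noteq> 0" by (rule rationally_independent_nonzero[OF indep])
  have slab: "finite (slab s t)"
    "real (card (slab s t)) \<le> (2 * (t / c) + 1) ^ (CARD('n) - 1) * ((t - s) / \<bar>a $ i\<bar> + 1)"
    if "0 \<le> t" "s \<le> t" for s t
  proof -
    have *: "c * norm (real_vec u) \<le> real_vec u \<bullet> a" "s \<le> real_vec u \<bullet> a \<and> real_vec u \<bullet> a < t"
      if "u \<in> slab s t" for u
      using that c(2) by (auto simp: slab_def h_def)
    show "finite (slab s t)"
      using c(1) that ai * by (rule card_lattice_slab(1))
    show "real (card (slab s t)) \<le> (2 * (t / c) + 1) ^ (CARD('n) - 1) * ((t - s) / \<bar>a $ i\<bar> + 1)"
      using c(1) that ai * by (rule card_lattice_slab(2))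
  qed
  \<comment> \<open>\<open>D\<close> and \<open>C\<close> collect all factors independent of
    \<open>J\<close>, \<open>x\<close> and \<open>N\<close>. In the bound, \<open>h x + 1\<close>
    instead of \<open>h x\<close> absorbs the rounding term of the lattice count.\<close>
  define D where "D = (2 * (\<beta> / c) + 1) ^ (CARD('n) - 1)"
  define C where "C = real f * D * (1 / \<bar>a $ i\<bar> + 1)"
  have D: "0 \<le> D" using \<beta>(1) c(1) by (simp add: D_def)
  then have "0 \<le> C" by (simp add: C_def)
  moreover have "\<exists>k. colength (ring_on R) J \<le> enat k \<and>
      real k \<le> C * (h x + 1) * real N ^ (CARD('n) - 1)"
    if J: "ideal J (ring_on R)" "x \<in> J" "x \<noteq> 0" "0 < N" "ideal_power (ring_on R) \<mm> N \<subseteq> J"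
    for J x N
  proof -
    have J': "submodule_on J" "J \<subseteq> R" using J(1) by (auto simp: ideal_iff)
    then have hx: "0 \<le> h x" using J h_nonneg by auto
    define t where "t = real N * \<beta>"
    have t: "0 \<le> t" using \<beta>(1) by (simp add: t_def)
    define k where "k = f * card (slab (t - h x) t)"
    have "length_le J R k"
    proof (rule length_le_principal[where A = "Rge t" and E = "Rge (t - h x)" and x = x])
      show "length_le (Rge t) (Rge (t - h x)) k"
        unfolding k_def using slab(1) t hx by (intro length_le_slab graded) auto
      \<comment> \<open>This bound provides finiteness. The \<open>max 0\<close> covers the case
        \<open>t < h x\<close>, where the ideal is all of \<open>R\<close>.\<close>
      show "length_le (Rge (t - h x)) R (f * card (slab 0 (max 0 (t - h x))))"
      proof -
        have "length_le (Rge (max 0 (t - h x))) (Rge 0) (f * card (slab 0 (max 0 (t - h x))))"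
          using slab(1) by (intro length_le_slab graded) auto
        moreover have "Rge (max 0 (t - h x)) \<subseteq> Rge (t - h x)" by (intro Rge_antimono) simp
        ultimately show ?thesis using Rge_nonpos[of 0] length_le_mono by auto
      qed
      show "Rge t \<subseteq> Rge (t - h x)" using hx by (intro Rge_antimono) simp
      \<comment> \<open>Additivity of \<open>h\<close> makes the colon of \<open>Rge t\<close> by
        \<open>x\<close> an ideal of the same kind.\<close>
      show "z \<in> Rge (t - h x)" if "z \<in> R" "x * z \<in> Rge t" for z
        using that h_mult[of x z] J(3) by (auto simp: Rge_def)
      show "Rge t \<subseteq> J"
      proof
        fix z assume "z \<in> Rge t"
        then show "z \<in> J"
          using \<beta>(2)[of z N] J(5) submodule_onD(1)[OF J'(1)]
          by (cases "z = 0") (auto simp: Rge_def t_def)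
      qed
    qed (use submodule_on_Rge Rge_subset J J' in auto)
    then have "colength (ring_on R) J \<le> enat k" by (rule colength_le[OF J(1)])
    moreover have "real k \<le> C * (h x + 1) * real N ^ (CARD('n) - 1)"
    proof -
      have "2 * (t / c) + 1 \<le> real N * (2 * (\<beta> / c) + 1)"
        using J(4) by (simp add: t_def algebra_simps)
      then have "(2 * (t / c) + 1) ^ (CARD('n) - 1) \<le> (real N * (2 * (\<beta> / c) + 1)) ^ (CARD('n) - 1)"
        using t c(1) by (intro power_mono) auto
      also have "\<dots> = D * real N ^ (CARD('n) - 1)"
        by (simp add: D_def power_mult_distrib mult.commute)
      finally have le1: "(2 * (t / c) + 1) ^ (CARD('n) - 1) \<le> D * real N ^ (CARD('n) - 1)" .
      have le2: "(t - (t - h x)) / \<bar>a $ i\<bar> + 1 \<le> (1 / \<bar>a $ i\<bar> + 1) * (h x + 1)"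
      proof -
        have "h x / \<bar>a $ i\<bar> \<le> (h x + 1) / \<bar>a $ i\<bar>" by (intro divide_right_mono) auto
        then show ?thesis using hx by (simp add: algebra_simps)
      qed
      have "real (card (slab (t - h x) t))
          \<le> (2 * (t / c) + 1) ^ (CARD('n) - 1) * ((t - (t - h x)) / \<bar>a $ i\<bar> + 1)"
        using t hx by (intro slab(2)) auto
      also have "\<dots> \<le> (D * real N ^ (CARD('n) - 1)) * ((1 / \<bar>a $ i\<bar> + 1) * (h x + 1))"
        using le1 le2 D hx by (intro mult_mono) auto
      finally have "real f * real (card (slab (t - h x) t))
          \<le> real f * ((D * real N ^ (CARD('n) - 1)) * ((1 / \<bar>a $ i\<bar> + 1) * (h x + 1)))"
        by (intro mult_left_mono) auto
      then show ?thesis by (simp add: k_def C_def mult_ac)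
    qed
    ultimately show ?thesis by blast
  qed
  ultimately show thesis using that by blast
qed

end

section \<open>Bounds for limits of normalised colengths\<close>

lemma lim_ereal_pos:
  fixes f :: "nat \<Rightarrow> ereal" and r :: "nat \<Rightarrow> nat"
  assumes "convergent f" "strict_mono r" "0 < \<epsilon>" "\<And>j. \<epsilon> \<le> f (r j)"
  shows "0 < lim f"
proof -
  have "(f \<circ> r) \<longlonglongrightarrow> lim f"
    using assms(1,2) by (intro LIMSEQ_subseq_LIMSEQ) (simp_all add: convergent_LIMSEQ_iff)
  then have "\<epsilon> \<le> lim f" using assms(4) by (intro LIMSEQ_le_const) auto
  with assms(3) show ?thesis by simp
qed

text \<open>For a convergent sequence, small terms at arbitrarily late indices already control the
  limit.\<close>

lemma lim_ereal_nonpos: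
  fixes f :: "nat \<Rightarrow> ereal"
  assumes "convergent f" and "\<And>m. 0 < m \<Longrightarrow> \<exists>n\<ge>m. f n \<le> ereal (D / real m)"
  shows "lim f \<le> 0"
proof (rule ccontr)
  assume "\<not> lim f \<le> 0"
  then obtain \<epsilon> where \<epsilon>: "0 < ereal \<epsilon>" "ereal \<epsilon> < lim f"
    using ereal_dense2[of 0 "lim f"] by (metis not_le)
  have "f \<longlonglongrightarrow> lim f" using assms(1) by (simp add: convergent_LIMSEQ_iff)
  then have "\<forall>\<^sub>F n in sequentially. ereal \<epsilon> < f n" using \<epsilon>(2) by (rule order_tendstoD(1))
  then obtain M where M: "\<And>n. M \<le> n \<Longrightarrow> ereal \<epsilon> < f n"
    by (auto simp: eventually_sequentially)
  obtain m\<^sub>0 :: nat where m\<^sub>0: "D / \<epsilon> \<le> real m\<^sub>0" using real_arch_simple by blast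
  \<comment> \<open>Past the threshold \<open>M\<close>, large enough for
    \<open>D / m \<le> \<epsilon>\<close>, and positive.\<close>
  define m where "m = max (max M m\<^sub>0) 1"
  have "0 < m" by (simp add: m_def)
  then obtain n where n: "m \<le> n" "f n \<le> ereal (D / real m)" using assms(2) by blast
  have "D / \<epsilon> \<le> real m" using m\<^sub>0 by (simp add: m_def)
  then have "D / real m \<le> \<epsilon>" using \<epsilon>(1) by (simp add: field_simps m_def)
  with n(2) have "f n \<le> ereal \<epsilon>" by (meson ereal_less_eq(3) order_trans)
  moreover have "ereal \<epsilon> < f n" using M n(1) by (simp add: m_def)
  ultimately show False by simp
qed

lemma normalized_colength_ge:
  assumes "enat (j ^ d) \<le> colength (ring_on R) (I (K * j))" "0 < j" "0 < K"
  shows "ereal (1 / real K ^ d) \<le> normalized_colength R d I (K * j)"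
proof -
  have "ereal (real j ^ d) \<le> ereal_of_enat (colength (ring_on R) (I (K * j)))"
    using ereal_of_enat_le_iff[THEN iffD2, OF assms(1)] by simp
  then have "ereal (real j ^ d) / ereal (real (K * j) ^ d) \<le> normalized_colength R d I (K * j)"
    unfolding normalized_colength_def using assms by (intro ereal_divide_right_mono) auto
  moreover have "ereal (real j ^ d) / ereal (real (K * j) ^ d) = ereal (1 / real K ^ d)"
    using assms by (simp add: power_mult_distrib)
  ultimately show ?thesis by simp
qed

lemma normalized_colength_le:
  assumes "colength (ring_on R) (I n) \<le> enat k" "real k \<le> B * real n ^ (d - 1)" "0 < n" "0 < d"
  shows "normalized_colength R d I n \<le> ereal (B / real n)"
proof -
  have "ereal_of_enat (colength (ring_on R) (I n)) \<le> ereal (real k)"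
    using ereal_of_enat_le_iff[THEN iffD2, OF assms(1)] by simp
  also have "\<dots> \<le> ereal (B * real n ^ (d - 1))" using assms(2) by simp
  finally have "normalized_colength R d I n \<le> ereal (B * real n ^ (d - 1)) / ereal (real n ^ d)"
    unfolding normalized_colength_def using assms(3) by (intro ereal_divide_right_mono) auto
  \<comment> \<open>One factor \<open>n\<close> splits off from \<open>n ^ d\<close> because
    \<open>d > 0\<close>.\<close>
  also have "\<dots> = ereal (B / real n)"
    using assms(3,4) by (cases d) (auto simp: field_simps)
  finally show ?thesis .
qed

context ok_valuation
begin

text \<open>The upper estimate shared by both kinds of families, with \<open>c\<close> the constant
  of BBL: it is small once \<open>h x + 1\<close> is small relative to \<open>n\<close>.\<close>

lemma normalized_colength_le_value:
  obtains C where "0 \<le> C" "\<And>I n x c. ideal (I n) (ring_on R) \<Longrightarrow> x \<in> I n \<Longrightarrow> x \<noteq> 0 \<Longrightarrow> 0 < n \<Longrightarrow>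
    ideal_power (ring_on R) \<mm> (c * n) \<subseteq> I n \<Longrightarrow>
    normalized_colength R CARD('n) I n
      \<le> ereal (C * real (c + 1) ^ (CARD('n) - 1) * ((h x + 1) / real n))"
proof -
  obtain C where C: "0 \<le> C" "\<And>J x N. ideal J (ring_on R) \<Longrightarrow> x \<in> J \<Longrightarrow> x \<noteq> 0 \<Longrightarrow> 0 < N \<Longrightarrow>
    ideal_power (ring_on R) \<mm> N \<subseteq> J \<Longrightarrow>
    \<exists>k. colength (ring_on R) J \<le> enat k \<and> real k \<le> C * (h x + 1) * real N ^ (CARD('n) - 1)"
    using colength_le_value by metis
  have "normalized_colength R CARD('n) I n
      \<le> ereal (C * real (c + 1) ^ (CARD('n) - 1) * ((h x + 1) / real n))"
    if *: "ideal (I n) (ring_on R)" "x \<in> I n" "x \<noteq> 0" "0 < n"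
      "ideal_power (ring_on R) \<mm> (c * n) \<subseteq> I n" for I n x c
  proof -
    \<comment> \<open>The exponent must be positive and \<open>c\<close> may be 0, hence
      \<open>c + 1\<close>.\<close>
    have "ideal_power (ring_on R) \<mm> ((c + 1) * n) \<subseteq> I n"
      using *(5) ideal_power_antimono[OF ideal_maximal, of "c * n" "(c + 1) * n"] by auto
    then obtain k where k: "colength (ring_on R) (I n) \<le> enat k"
      "real k \<le> C * (h x + 1) * real ((c + 1) * n) ^ (CARD('n) - 1)"
      using C(2)[OF *(1-3), of "(c + 1) * n"] *(4) by auto
    have "real k \<le> (C * (h x + 1) * real (c + 1) ^ (CARD('n) - 1)) * real n ^ (CARD('n) - 1)"
      using k(2) by (simp only: of_nat_mult power_mult_distrib mult.assoc)
    then have "normalized_colength R CARD('n) I n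
        \<le> ereal (C * (h x + 1) * real (c + 1) ^ (CARD('n) - 1) / real n)"
      using k(1) *(4) by (intro normalized_colength_le) auto
    then show ?thesis by (simp add: mult_ac)
  qed
  with C(1) show thesis using that by blast
qed

section \<open>Families indexed by the natural numbers\<close>

lemma BAL_imp_lim_pos:
  assumes "\<And>n. ideal (I n) (ring_on R)" "BAL R \<mm> I" "convergent (normalized_colength R CARD('n) I)"
  shows "0 < lim (normalized_colength R CARD('n) I)"
proof -
  obtain K\<^sub>0 where K\<^sub>0: "\<And>K j J. K\<^sub>0 \<le> K \<Longrightarrow> ideal J (ring_on R) \<Longrightarrow>
    J \<subseteq> ideal_power (ring_on R) \<mm> (K * j) \<Longrightarrow> enat (j ^ CARD('n)) \<le> colength (ring_on R) J"
    using colength_ge_pow by metis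
  define K where "K = max K\<^sub>0 1"
  obtain c where c: "0 < c" "\<And>n. I n \<subseteq> ideal_power (ring_on R) \<mm> (n div c)"
    using assms(2) by (auto simp: BAL_def)
  show ?thesis
  proof (rule lim_ereal_pos[OF assms(3)])
    \<comment> \<open>On multiples of \<open>c\<close> the division in BAL is exact;
      \<open>Suc j\<close> keeps the index positive.\<close>
    show "strict_mono (\<lambda>j. c * K * Suc j)"
      using c(1) by (auto simp: strict_mono_Suc_iff K_def)
    show "0 < ereal (1 / real (c * K) ^ CARD('n))" using c(1) by (simp add: K_def)
    fix j
    have "I (c * K * Suc j) \<subseteq> ideal_power (ring_on R) \<mm> (K * Suc j)"
      using c(2)[of "c * K * Suc j"] c(1) by (simp only: mult.assoc nonzero_mult_div_cancel_left)
    then have "enat (Suc j ^ CARD('n)) \<le> colength (ring_on R) (I (c * K * Suc j))"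
      using K\<^sub>0[of K] assms(1) by (auto simp: K_def)
    then show "ereal (1 / real (c * K) ^ CARD('n))
        \<le> normalized_colength R CARD('n) I (c * K * Suc j)"
      using c(1) by (intro normalized_colength_ge) (auto simp: K_def)
  qed
qed

text \<open>If BAL fails, then for every \<open>m\<close> some \<open>I n\<close> with \<open>n \<ge> m\<close> contains an element of value at
  most \<open>\<beta> n / m\<close>.  As the limit is assumed to exist, these sparse indices determine it.\<close>

lemma not_BAL_imp_lim_nonpos:
  assumes "\<And>n. ideal (I n) (ring_on R)" "BBL R \<mm> I" "\<not> BAL R \<mm> I"
    "convergent (normalized_colength R CARD('n) I)"
  shows "lim (normalized_colength R CARD('n) I) \<le> 0"
proof -
  obtain c where c: "\<And>n. ideal_power (ring_on R) \<mm> (c * n) \<subseteq> I n"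
    using assms(2) by (auto simp: BBL_def)
  obtain \<beta> where \<beta>: "0 < \<beta>"
    "\<And>n x. x \<in> R \<Longrightarrow> x \<noteq> 0 \<Longrightarrow> real n * \<beta> \<le> h x \<Longrightarrow> x \<in> ideal_power (ring_on R) \<mm> n"
    using ideal_power_contains by metis
  obtain C where C: "0 \<le> C" "\<And>I n x c. ideal (I n) (ring_on R) \<Longrightarrow> x \<in> I n \<Longrightarrow> x \<noteq> 0 \<Longrightarrow> 0 < n \<Longrightarrow>
    ideal_power (ring_on R) \<mm> (c * n) \<subseteq> I n \<Longrightarrow>
    normalized_colength R CARD('n) I n
      \<le> ereal (C * real (c + 1) ^ (CARD('n) - 1) * ((h x + 1) / real n))"
    using normalized_colength_le_value by metis
  define B where "B = C * real (c + 1) ^ (CARD('n) - 1)"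
  have B: "0 \<le> B" using C(1) by (simp add: B_def)
  show ?thesis
  proof (rule lim_ereal_nonpos[OF assms(4)])
    fix m :: nat assume m: "0 < m"
    then obtain n where "\<not> I n \<subseteq> ideal_power (ring_on R) \<mm> (n div m)"
      using assms(3) unfolding BAL_def by blast
    then obtain x where x: "x \<in> I n" "x \<notin> ideal_power (ring_on R) \<mm> (n div m)" by auto
    have "x \<in> R" using x(1) assms(1)[of n] by (auto simp: ideal_iff)
    \<comment> \<open>The zeroth power of \<open>\<mm>\<close> is \<open>R\<close> and cannot miss
      \<open>x\<close>. This forces \<open>n \<ge> m\<close>, as the limit criterion
      demands.\<close>
    then have "n div m \<noteq> 0" using x(2) ideal_power_0 by metis
    then have n: "m \<le> n" "0 < n" using m by (auto simp: div_eq_0_iff)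
    have "x \<noteq> 0"
      using x(2) ideal_ideal_power[OF ideal_maximal] submodule_onD(1) by (auto simp: ideal_iff)
    then have "h x \<le> real (n div m) * \<beta>" using \<beta>(2)[OF \<open>x \<in> R\<close>, of "n div m"] x(2) by force
    also have "\<dots> \<le> real n / real m * \<beta>"
      using \<beta>(1) of_nat_div_le_of_nat[of n m] by (intro mult_right_mono) auto
    finally have "(h x + 1) / real n \<le> (real n / real m * \<beta> + 1) / real n"
      by (intro divide_right_mono) auto
    also have "\<dots> = \<beta> / real m + 1 / real n" using n(2) by (simp add: add_divide_distrib)
    also have "\<dots> \<le> \<beta> / real m + 1 / real m" using n(1) m by (intro add_left_mono divide_left_mono) auto
    also have "\<dots> = (\<beta> + 1) / real m" by (simp add: add_divide_distrib)
    finally have "B * ((h x + 1) / real n) \<le> B * ((\<beta> + 1) / real m)"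
      using B by (rule mult_left_mono)
    then have "ereal (B * ((h x + 1) / real n)) \<le> ereal (B * (\<beta> + 1) / real m)"
      by (simp only: ereal_less_eq times_divide_eq_right)
    moreover have "normalized_colength R CARD('n) I n \<le> ereal (B * ((h x + 1) / real n))"
      unfolding B_def by (intro C(2) assms(1) x(1) \<open>x \<noteq> 0\<close> n(2) c)
    ultimately have "normalized_colength R CARD('n) I n \<le> ereal (B * (\<beta> + 1) / real m)"
      by (rule order_trans[rotated])
    with n(1) show "\<exists>n\<ge>m. normalized_colength R CARD('n) I n \<le> ereal (B * (\<beta> + 1) / real m)"
      by blast
  qed
qed

section \<open>Families indexed by powers of \<open>p\<close>\<close>

text \<open>Frobenius powers lie in ordinary powers, so the lower bound for ideals inside powers of
  \<open>\<mm>\<close> applies along a tail of the exponents.\<close>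

lemma BAL_p_imp_lim_pos:
  assumes "1 < p" "\<And>e. ideal (I (p ^ e)) (ring_on R)" "BAL_p p R \<mm> I"
    "convergent (\<lambda>e. normalized_colength R CARD('n) I (p ^ e))"
  shows "0 < lim (\<lambda>e. normalized_colength R CARD('n) I (p ^ e))"
proof -
  obtain K\<^sub>0 where K\<^sub>0: "\<And>K j J. K\<^sub>0 \<le> K \<Longrightarrow> ideal J (ring_on R) \<Longrightarrow>
    J \<subseteq> ideal_power (ring_on R) \<mm> (K * j) \<Longrightarrow> enat (j ^ CARD('n)) \<le> colength (ring_on R) J"
    using colength_ge_pow by metis
  \<comment> \<open>The factor \<open>p ^ K\<^sub>0\<close> is admissible as \<open>K\<close> and
    keeps all indices powers of \<open>p\<close>.\<close>
  have K\<^sub>0': "K\<^sub>0 \<le> p ^ K\<^sub>0" using assms(1) by (simp add: less_imp_le power_gt_expt)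
  obtain e\<^sub>0 where e\<^sub>0: "\<And>e. I (p ^ e * p ^ e\<^sub>0) \<subseteq> frobenius_power (ring_on R) \<mm> (p ^ e)"
    using assms(3) by (auto simp: BAL_p_def)
  show ?thesis
  proof (rule lim_ereal_pos[OF assms(4)])
    show "strict_mono (\<lambda>j. K\<^sub>0 + e\<^sub>0 + j)" by (auto simp: strict_mono_Suc_iff)
    show "0 < ereal (1 / real (p ^ (K\<^sub>0 + e\<^sub>0)) ^ CARD('n))" using assms(1) by simp
    fix j
    have split: "p ^ (K\<^sub>0 + j) * p ^ e\<^sub>0 = p ^ (K\<^sub>0 + e\<^sub>0) * p ^ j"
      by (simp add: power_add)
    have "I (p ^ (K\<^sub>0 + e\<^sub>0) * p ^ j) \<subseteq> ideal_power (ring_on R) \<mm> (p ^ (K\<^sub>0 + j))"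
      using e\<^sub>0[of "K\<^sub>0 + j"] frobenius_power_subset[OF ideal_maximal] unfolding split by blast
    then have "enat ((p ^ j) ^ CARD('n)) \<le> colength (ring_on R) (I (p ^ (K\<^sub>0 + e\<^sub>0) * p ^ j))"
      using K\<^sub>0[OF K\<^sub>0', of _ "p ^ j"] assms(2)[of "K\<^sub>0 + e\<^sub>0 + j"] by (simp add: power_add)
    then have "ereal (1 / real (p ^ (K\<^sub>0 + e\<^sub>0)) ^ CARD('n))
        \<le> normalized_colength R CARD('n) I (p ^ (K\<^sub>0 + e\<^sub>0) * p ^ j)"
      using assms(1) by (intro normalized_colength_ge) auto
    then show "ereal (1 / real (p ^ (K\<^sub>0 + e\<^sub>0)) ^ CARD('n))
        \<le> normalized_colength R CARD('n) I (p ^ (K\<^sub>0 + e\<^sub>0 + j))"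
      by (simp only: power_add)
  qed
qed

text \<open>An element outside the Frobenius power of order \<open>q = p ^ e\<close> lies outside
  the ordinary power of exponent \<open>\<mu> q\<close>, so its height is at most
  \<open>\<mu> q \<beta>\<close>. Failure of BAL supplies such elements at the index
  \<open>q * p ^ m\<close> for every \<open>m\<close>.\<close>

lemma not_BAL_p_imp_lim_nonpos:
  assumes "1 < p" "\<And>e. ideal (I (p ^ e)) (ring_on R)" "BBL_p p R \<mm> I" "\<not> BAL_p p R \<mm> I"
    "convergent (\<lambda>e. normalized_colength R CARD('n) I (p ^ e))"
  shows "lim (\<lambda>e. normalized_colength R CARD('n) I (p ^ e)) \<le> 0"
proof -
  obtain c where c: "\<And>e. ideal_power (ring_on R) \<mm> (c * p ^ e) \<subseteq> I (p ^ e)"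
    using assms(3) by (auto simp: BBL_p_def)
  obtain \<beta> where \<beta>: "0 < \<beta>"
    "\<And>n x. x \<in> R \<Longrightarrow> x \<noteq> 0 \<Longrightarrow> real n * \<beta> \<le> h x \<Longrightarrow> x \<in> ideal_power (ring_on R) \<mm> n"
    using ideal_power_contains by metis
  obtain \<mu> where \<mu>: "\<And>q. q > 0 \<Longrightarrow>
    ideal_power (ring_on R) \<mm> (\<mu> * q) \<subseteq> frobenius_power (ring_on R) \<mm> q"
    using ideal_power_subset_frobenius_power[OF ideal_maximal] by metis
  obtain C where C: "0 \<le> C" "\<And>I n x c. ideal (I n) (ring_on R) \<Longrightarrow> x \<in> I n \<Longrightarrow> x \<noteq> 0 \<Longrightarrow> 0 < n \<Longrightarrow>
    ideal_power (ring_on R) \<mm> (c * n) \<subseteq> I n \<Longrightarrow>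
    normalized_colength R CARD('n) I n
      \<le> ereal (C * real (c + 1) ^ (CARD('n) - 1) * ((h x + 1) / real n))"
    using normalized_colength_le_value by metis
  define B where "B = C * real (c + 1) ^ (CARD('n) - 1)"
  have B: "0 \<le> B" using C(1) by (simp add: B_def)
  define D where "D = B * (real \<mu> * \<beta> + 1)"
  have D: "0 \<le> D" using B \<beta>(1) by (simp add: D_def)
  show ?thesis
  proof (rule lim_ereal_nonpos[OF assms(5)])
    fix m :: nat assume m: "0 < m"
    \<comment> \<open>Turns a bound decaying with \<open>p ^ m\<close> into the form
      \<open>D / m\<close> of the limit criterion.\<close>
    have pm: "real m \<le> real p ^ m"
      using power_gt_expt[of p m] assms(1) by (simp flip: of_nat_power)
    obtain e where "\<not> I (p ^ e * p ^ m) \<subseteq> frobenius_power (ring_on R) \<mm> (p ^ e)"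
      using assms(4) unfolding BAL_p_def by blast
    then obtain x where x: "x \<in> I (p ^ (e + m))" "x \<notin> frobenius_power (ring_on R) \<mm> (p ^ e)"
      by (auto simp: power_add)
    have "x \<in> R" using x(1) assms(2)[of "e + m"] by (auto simp: ideal_iff)
    have "x \<noteq> 0"
      using x(2) ideal_frobenius_power[OF ideal_maximal] submodule_onD(1) by (auto simp: ideal_iff)
    have q: "0 < p ^ e" using assms(1) by simp
    have "x \<notin> ideal_power (ring_on R) \<mm> (\<mu> * p ^ e)" using x(2) \<mu>[OF q] by blast
    then have hx: "h x \<le> real (\<mu> * p ^ e) * \<beta>"
      using \<beta>(2)[OF \<open>x \<in> R\<close> \<open>x \<noteq> 0\<close>, of "\<mu> * p ^ e"] by force
    have "(h x + 1) / real (p ^ (e + m)) \<le> (real \<mu> * \<beta> * real p ^ e + real p ^ e) / real (p ^ (e + m))"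
      using hx assms(1) by (intro divide_right_mono add_mono) (auto simp: mult_ac)
    also have "\<dots> = (real \<mu> * \<beta> + 1) / real p ^ m"
      using assms(1) by (simp add: power_add field_simps)
    also have "\<dots> \<le> (real \<mu> * \<beta> + 1) / real m"
      using pm m \<beta>(1) assms(1) by (intro divide_left_mono) (auto intro!: mult_pos_pos)
    finally have "B * ((h x + 1) / real (p ^ (e + m))) \<le> B * ((real \<mu> * \<beta> + 1) / real m)"
      using B by (rule mult_left_mono)
    then have "ereal (B * ((h x + 1) / real (p ^ (e + m)))) \<le> ereal (D / real m)"
      by (simp only: ereal_less_eq times_divide_eq_right D_def)
    moreover have "normalized_colength R CARD('n) I (p ^ (e + m))
        \<le> ereal (B * ((h x + 1) / real (p ^ (e + m))))"
      unfolding B_def using assms(1) by (intro C(2) assms(2) x(1) \<open>x \<noteq> 0\<close> c) auto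
    ultimately have "normalized_colength R CARD('n) I (p ^ (e + m)) \<le> ereal (D / real m)"
      by (rule order_trans[rotated])
    then show "\<exists>n\<ge>m. normalized_colength R CARD('n) I (p ^ n) \<le> ereal (D / real m)"
      by (intro exI[of _ "e + m"]) simp
  qed
qed

end

theorem theorem2:
  fixes R :: "'k::field set" and \<mm> :: "'k set" and d :: nat
  assumes "OK_domain TYPE('n::finite) R \<mm>" and "d = CARD('n)"
  shows
    "(\<forall>I. weakly_graded R I \<longrightarrow> BBL R \<mm> I \<longrightarrow>
        convergent (\<lambda>n. normalized_colength R d I n) \<longrightarrow>
        (BAL R \<mm> I \<longleftrightarrow> lim (\<lambda>n. normalized_colength R d I n) > 0)) \<and>
     (\<forall>p I. prime p \<longrightarrow> CHAR('k) = p \<longrightarrow> BBL_p p R \<mm> I \<longrightarrow>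
        weakly_p_family p R I \<or>
          (F_finite p R \<and> perfect_residue_field p R \<mm> \<and> weakly_inverse_p_family p R I) \<longrightarrow>
        convergent (\<lambda>e. normalized_colength R d I (p ^ e)) \<longrightarrow>
        (BAL_p p R \<mm> I \<longleftrightarrow> lim (\<lambda>e. normalized_colength R d I (p ^ e)) > 0))"
proof -
  obtain a :: "real ^ 'n" and \<nu> where "noetherian_local_domain R \<mm>"
    "rationally_independent a" "OK_valuation a \<nu> R \<mm>"
    using assms(1) by (auto simp: OK_domain_def)
  then interpret ok_valuation R \<mm> a \<nu>
    by (intro ok_valuation.intro ok_valuation_axioms.intro)
  show ?thesis
    unfolding assms(2)
  proof (intro conjI allI impI)
    fix I assume I: "weakly_graded R I" "BBL R \<mm> I"
      "convergent (\<lambda>n. normalized_colength R CARD('n) I n)"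
    then have "ideal (I n) (ring_on R)" for n by (simp add: weakly_graded_def)
    \<comment> \<open>BAL makes the limit positive and its failure makes the limit at most 0;
      together these give the equivalence.\<close>
    with I show "BAL R \<mm> I \<longleftrightarrow> lim (\<lambda>n. normalized_colength R CARD('n) I n) > 0"
      using BAL_imp_lim_pos[of I] not_BAL_imp_lim_nonpos[of I] by force
  next
    fix p I assume I: "prime p" "BBL_p p R \<mm> I"
      "weakly_p_family p R I \<or>
        F_finite p R \<and> perfect_residue_field p R \<mm> \<and> weakly_inverse_p_family p R I"
      "convergent (\<lambda>e. normalized_colength R CARD('n) I (p ^ e))"
    then have "ideal (I (p ^ e)) (ring_on R)" for e
      by (auto simp: weakly_p_family_def weakly_inverse_p_family_def)
    with I show "BAL_p p R \<mm> I \<longleftrightarrow> lim (\<lambda>e. normalized_colength R CARD('n) I (p ^ e)) > 0"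
      using BAL_p_imp_lim_pos[of p I] not_BAL_p_imp_lim_nonpos[of p I] prime_gt_1_nat by force
  qed
qed

end
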